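(* Let $m,n\ge 1$, let $R$ be an associative unital $F$-algebra, and let $A=(a_{i_1\ldots i_m})_{1\le i_1,\ldots,i_m\le n}$ be a hypermatrix of elements of $R$. Fix $k\in\{1,\ldots,m\}$ and let $x_i^{(k)}=\sum_{\alpha\in[1,n]^{m-1}}a^{(k)}_{i\alpha}x_\alpha\in R\otimes\Lambda^{\otimes(m-1)}$ for $1\le i\le n$. Then the following two statements are equivalent. (i) $x_j^{(k)}x_i^{(k)}=-q\,x_i^{(k)}x_j^{(k)}$ for all $1\le i<j\le n$, and $x_i^{(k)}x_i^{(k)}=0$ for all $1\le i\le n$. (ii) For every $J=I_1\times\cdots\times I_{m-1}\subset[1,n]^{m-1}$ with $|I_s|=2$ for all $s$, one has $$\sum_{\alpha\sqcup\beta=J}(-q)^{\mathrm{inv}(\alpha,\beta)}a^{(k)}_{i\alpha}a^{(k)}_{i\beta}=0\qquad(1\le i\le n),$$ $$\sum_{\alpha\sqcup\beta=J}(-q)^{\mathrm{inv}(\alpha,\beta)}a^{(k)}_{j\alpha}a^{(k)}_{i\beta}=-q\sum_{\alpha\sqcup\beta=J}(-q)^{\mathrm{inv}(\alpha,\beta)}a^{(k)}_{i\alpha}a^{(k)}_{j\beta}\qquad(1\le i<j\le n).$$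
   Context: $q$ is a nonzero complex number with $q^2\ne-1$; $F$ is the ground field, an extension field of $\mathbb C$; $[1,n]=\{1,\ldots,n\}$. The quantum exterior algebra $\Lambda=\Lambda_n$ is the unital associative $F$-algebra generated by $x_1,\ldots,x_n$ (product written $\wedge$) with relations $x_j\wedge x_i=-q\,x_i\wedge x_j$ for $i<j$ and $x_i\wedge x_i=0$; it has basis $x_{i_1}\wedge\cdots\wedge x_{i_r}$, $i_1<\cdots<i_r$. For $\alpha=(\alpha_1,\ldots,\alpha_{m-1})\in[1,n]^{m-1}$ put $x_\alpha=x_{\alpha_1}\otimes\cdots\otimes x_{\alpha_{m-1}}\in\Lambda^{\otimes(m-1)}$. The algebra $\Lambda^{\otimes(m-1)}$ has the componentwise product, and in $R\otimes\Lambda^{\otimes(m-1)}$ elements of $R$ commute with elements of $\Lambda^{\otimes(m-1)}$. For $\alpha=(j_1,\ldots,j_{k-1},j_{k+1},\ldots,j_m)\in[1,n]^{m-1}$ put $a^{(k)}_{i\alpha}=a_{j_1\ldots j_{k-1}\,i\,j_{k+1}\ldots j_m}$ ($i$ in the $k$-th place). For $J=I_1\times\cdots\times I_{m-1}$ with all $|I_s|=2$, the notation $\alpha\sqcup\beta=J$ means that the sum runs over all pairs $\alpha=(\alpha_1,\ldots,\alpha_{m-1})$, $\beta=(\beta_1,\ldots,\beta_{m-1})$ with $\{\alpha_s,\beta_s\}=I_s$ for every $s$; and $\mathrm{inv}(\alpha,\beta)=|\{s:\alpha_s>\beta_s\}|$. *)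

theory Defs
  imports "HOL-Algebra.Algebra" "HOL-Algebra.Algebraic_Closure_Type"
begin

section \<open>Associative unital algebras\<close>

text \<open>The library locale \<^locale>\<open>algebra\<close> is restricted to commutative multiplication.\<close>

locale assoc_algebra = module F A + A?: ring A for F (structure) and A (structure) +
  assumes smult_mult_l:
      "\<lbrakk>c \<in> carrier F; x \<in> carrier A; y \<in> carrier A\<rbrakk>
        \<Longrightarrow> (c \<odot>\<^bsub>A\<^esub> x) \<otimes>\<^bsub>A\<^esub> y = c \<odot>\<^bsub>A\<^esub> (x \<otimes>\<^bsub>A\<^esub> y)"
    and smult_mult_r:
      "\<lbrakk>c \<in> carrier F; x \<in> carrier A; y \<in> carrier A\<rbrakk>
        \<Longrightarrow> x \<otimes>\<^bsub>A\<^esub> (c \<odot>\<^bsub>A\<^esub> y) = c \<odot>\<^bsub>A\<^esub> (x \<otimes>\<^bsub>A\<^esub> y)"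

definition quotient_algebra ::
    "('f, 'a, 'c) module_scheme \<Rightarrow> 'a set \<Rightarrow> ('f, 'a set) module"
  where "quotient_algebra A I =
    \<lparr>carrier = carrier (A Quot I), monoid.mult = monoid.mult (A Quot I), one = one (A Quot I),
     ring.zero = ring.zero (A Quot I), add = add (A Quot I),
     module.smult = (\<lambda>c C. \<Union>x\<in>C. I +>\<^bsub>A\<^esub> (c \<odot>\<^bsub>A\<^esub> x))\<rparr>"

section \<open>Monoid algebras\<close>

definition monoid_algebra ::
    "('f, 'c) ring_scheme \<Rightarrow> ('m, 'd) monoid_scheme \<Rightarrow> ('f, 'm \<Rightarrow> 'f) module"
  where "monoid_algebra F M =
    \<lparr>carrier = {f. finite {u. f u \<noteq> \<zero>\<^bsub>F\<^esub>} \<and> {u. f u \<noteq> \<zero>\<^bsub>F\<^esub>} \<subseteq> carrier M \<and> range f \<subseteq> carrier F},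
     monoid.mult = (\<lambda>f g w. \<Oplus>\<^bsub>F\<^esub>p \<in> {(u, v). f u \<noteq> \<zero>\<^bsub>F\<^esub> \<and> g v \<noteq> \<zero>\<^bsub>F\<^esub> \<and> u \<otimes>\<^bsub>M\<^esub> v = w}.
              f (fst p) \<otimes>\<^bsub>F\<^esub> g (snd p)),
     one = (\<lambda>w. if w = \<one>\<^bsub>M\<^esub> then \<one>\<^bsub>F\<^esub> else \<zero>\<^bsub>F\<^esub>),
     ring.zero = (\<lambda>w. \<zero>\<^bsub>F\<^esub>),
     add = (\<lambda>f g w. f w \<oplus>\<^bsub>F\<^esub> g w),
     module.smult = (\<lambda>c f w. c \<otimes>\<^bsub>F\<^esub> f w)\<rparr>"

definition basis_elt :: "('f, 'c) ring_scheme \<Rightarrow> 'm \<Rightarrow> 'm \<Rightarrow> 'f"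
  where "basis_elt F u = (\<lambda>w. if w = u then \<one>\<^bsub>F\<^esub> else \<zero>\<^bsub>F\<^esub>)"

section \<open>The quantum exterior algebra\<close>

definition free_monoid :: "'s set \<Rightarrow> 's list monoid"
  where "free_monoid S = \<lparr>carrier = lists S, monoid.mult = (@), one = []\<rparr>"

definition free_algebra :: "('f, 'c) ring_scheme \<Rightarrow> nat \<Rightarrow> ('f, nat list \<Rightarrow> 'f) module"
  where "free_algebra F n = monoid_algebra F (free_monoid {1..n})"

definition qext_relations :: "('f, 'c) ring_scheme \<Rightarrow> 'f \<Rightarrow> nat \<Rightarrow> (nat list \<Rightarrow> 'f) set"
  where "qext_relations F q n =
    (let T = free_algebra F n; g = (\<lambda>i. basis_elt F [i]) in
      {g j \<otimes>\<^bsub>T\<^esub> g i \<ominus>\<^bsub>T\<^esub> (\<ominus>\<^bsub>F\<^esub> q) \<odot>\<^bsub>T\<^esub> (g i \<otimes>\<^bsub>T\<^esub> g j) | i j. 1 \<le> i \<and> i < j \<and> j \<le> n}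
      \<union> {g i \<otimes>\<^bsub>T\<^esub> g i | i. 1 \<le> i \<and> i \<le> n})"

definition qext_ideal :: "('f, 'c) ring_scheme \<Rightarrow> 'f \<Rightarrow> nat \<Rightarrow> (nat list \<Rightarrow> 'f) set"
  where "qext_ideal F q n = Idl\<^bsub>free_algebra F n\<^esub> (qext_relations F q n)"

definition quantum_exterior ::
    "('f, 'c) ring_scheme \<Rightarrow> 'f \<Rightarrow> nat \<Rightarrow> ('f, (nat list \<Rightarrow> 'f) set) module"
  where "quantum_exterior F q n = quotient_algebra (free_algebra F n) (qext_ideal F q n)"

definition qext_gen :: "('f, 'c) ring_scheme \<Rightarrow> 'f \<Rightarrow> nat \<Rightarrow> nat \<Rightarrow> (nat list \<Rightarrow> 'f) set"
  where "qext_gen F q n i = qext_ideal F q n +>\<^bsub>free_algebra F n\<^esub> basis_elt F [i]"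

section \<open>Tensor products of algebras\<close>

text \<open>
  The algebra \<open>A \<otimes> B\<close> is the free module on the pairs \<open>(x, y)\<close> modulo the bilinearity
  relations. The componentwise product of pairs makes the free module a monoid algebra; the
  submodule spanned by the relations is stable under multiplication by pairs, so it is
  the ideal they generate.  The tensor power, built from tuples (lists of length \<open>r\<close>) and
  the multilinearity relations, is analogous; for \<open>r = 0\<close> it is \<open>F\<close>.
\<close>

definition tensor_relations ::
    "('f, 'c) ring_scheme \<Rightarrow> ('f, 'a, 'd) module_scheme \<Rightarrow> ('f, 'b, 'e) module_scheme
      \<Rightarrow> ('a \<times> 'b \<Rightarrow> 'f) set"
  where "tensor_relations F A B =
    (let T = monoid_algebra F (A \<times>\<times> B); P = (\<lambda>x y. basis_elt F (x, y)) in
      {P (x \<oplus>\<^bsub>A\<^esub> x') y \<ominus>\<^bsub>T\<^esub> (P x y \<oplus>\<^bsub>T\<^esub> P x' y) | x x' y.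
          x \<in> carrier A \<and> x' \<in> carrier A \<and> y \<in> carrier B}
      \<union> {P x (y \<oplus>\<^bsub>B\<^esub> y') \<ominus>\<^bsub>T\<^esub> (P x y \<oplus>\<^bsub>T\<^esub> P x y') | x y y'.
          x \<in> carrier A \<and> y \<in> carrier B \<and> y' \<in> carrier B}
      \<union> {P (c \<odot>\<^bsub>A\<^esub> x) y \<ominus>\<^bsub>T\<^esub> c \<odot>\<^bsub>T\<^esub> P x y | c x y.
          c \<in> carrier F \<and> x \<in> carrier A \<and> y \<in> carrier B}
      \<union> {P x (c \<odot>\<^bsub>B\<^esub> y) \<ominus>\<^bsub>T\<^esub> c \<odot>\<^bsub>T\<^esub> P x y | c x y.
          c \<in> carrier F \<and> x \<in> carrier A \<and> y \<in> carrier B})"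

definition tensor_ideal ::
    "('f, 'c) ring_scheme \<Rightarrow> ('f, 'a, 'd) module_scheme \<Rightarrow> ('f, 'b, 'e) module_scheme
      \<Rightarrow> ('a \<times> 'b \<Rightarrow> 'f) set"
  where "tensor_ideal F A B = Idl\<^bsub>monoid_algebra F (A \<times>\<times> B)\<^esub> (tensor_relations F A B)"

definition tensor_algebra ::
    "('f, 'c) ring_scheme \<Rightarrow> ('f, 'a, 'd) module_scheme \<Rightarrow> ('f, 'b, 'e) module_scheme
      \<Rightarrow> ('f, ('a \<times> 'b \<Rightarrow> 'f) set) module"
  where "tensor_algebra F A B =
    quotient_algebra (monoid_algebra F (A \<times>\<times> B)) (tensor_ideal F A B)"

definition pure_tensor ::
    "('f, 'c) ring_scheme \<Rightarrow> ('f, 'a, 'd) module_scheme \<Rightarrow> ('f, 'b, 'e) module_scheme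
      \<Rightarrow> 'a \<Rightarrow> 'b \<Rightarrow> ('a \<times> 'b \<Rightarrow> 'f) set"
  where "pure_tensor F A B x y =
    tensor_ideal F A B +>\<^bsub>monoid_algebra F (A \<times>\<times> B)\<^esub> basis_elt F (x, y)"

definition list_power_monoid :: "('a, 'c) monoid_scheme \<Rightarrow> nat \<Rightarrow> 'a list monoid"
  where "list_power_monoid M r =
    \<lparr>carrier = {xs. length xs = r \<and> set xs \<subseteq> carrier M},
     monoid.mult = map2 (monoid.mult M), one = replicate r \<one>\<^bsub>M\<^esub>\<rparr>"

definition tensor_power_relations ::
    "('f, 'c) ring_scheme \<Rightarrow> ('f, 'a, 'd) module_scheme \<Rightarrow> nat \<Rightarrow> ('a list \<Rightarrow> 'f) set"
  where "tensor_power_relations F A r =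
    (let L = list_power_monoid A r; T = monoid_algebra F L; P = basis_elt F in
      {P (xs[s := x \<oplus>\<^bsub>A\<^esub> y]) \<ominus>\<^bsub>T\<^esub> (P (xs[s := x]) \<oplus>\<^bsub>T\<^esub> P (xs[s := y])) | xs s x y.
          xs \<in> carrier L \<and> s < r \<and> x \<in> carrier A \<and> y \<in> carrier A}
      \<union> {P (xs[s := c \<odot>\<^bsub>A\<^esub> x]) \<ominus>\<^bsub>T\<^esub> c \<odot>\<^bsub>T\<^esub> P (xs[s := x]) | xs s c x.
          xs \<in> carrier L \<and> s < r \<and> c \<in> carrier F \<and> x \<in> carrier A})"

definition tensor_power_ideal ::
    "('f, 'c) ring_scheme \<Rightarrow> ('f, 'a, 'd) module_scheme \<Rightarrow> nat \<Rightarrow> ('a list \<Rightarrow> 'f) set"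
  where "tensor_power_ideal F A r =
    Idl\<^bsub>monoid_algebra F (list_power_monoid A r)\<^esub> (tensor_power_relations F A r)"

definition tensor_power ::
    "('f, 'c) ring_scheme \<Rightarrow> ('f, 'a, 'd) module_scheme \<Rightarrow> nat \<Rightarrow> ('f, ('a list \<Rightarrow> 'f) set) module"
  where "tensor_power F A r =
    quotient_algebra (monoid_algebra F (list_power_monoid A r)) (tensor_power_ideal F A r)"

definition power_tensor ::
    "('f, 'c) ring_scheme \<Rightarrow> ('f, 'a, 'd) module_scheme \<Rightarrow> nat \<Rightarrow> 'a list \<Rightarrow> ('a list \<Rightarrow> 'f) set"
  where "power_tensor F A r xs =
    tensor_power_ideal F A r +>\<^bsub>monoid_algebra F (list_power_monoid A r)\<^esub> basis_elt F xs"

section \<open>Hypermatrices\<close>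

text \<open>
  Multi-indices in \<open>[1,n]\<^sup>r\<close> are lists of length \<open>r\<close>; the components of a multi-index are
  therefore numbered from \<open>0\<close>, while the direction \<open>k\<close> of a hypermatrix runs through \<open>1, \<dots>, m\<close>.
\<close>

definition multi_indices :: "nat \<Rightarrow> nat \<Rightarrow> nat list set"
  where "multi_indices n r = {\<alpha>. length \<alpha> = r \<and> set \<alpha> \<subseteq> {1..n}}"

definition slice :: "(nat list \<Rightarrow> 'r) \<Rightarrow> nat \<Rightarrow> nat \<Rightarrow> nat list \<Rightarrow> 'r"
  where "slice a k i \<alpha> = a (take (k - 1) \<alpha> @ i # drop (k - 1) \<alpha>)"

definition tensor_space ::
    "('f, 'c) ring_scheme \<Rightarrow> 'f \<Rightarrow> ('f, 'r, 'd) module_scheme \<Rightarrow> nat \<Rightarrow> nat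
      \<Rightarrow> ('f, ('r \<times> ((nat list \<Rightarrow> 'f) set list \<Rightarrow> 'f) set \<Rightarrow> 'f) set) module"
  where "tensor_space F q R m n =
    tensor_algebra F R (tensor_power F (quantum_exterior F q n) (m - 1))"

definition gen_tensor ::
    "('f, 'c) ring_scheme \<Rightarrow> 'f \<Rightarrow> nat \<Rightarrow> nat \<Rightarrow> nat list \<Rightarrow> ((nat list \<Rightarrow> 'f) set list \<Rightarrow> 'f) set"
  where "gen_tensor F q m n \<alpha> =
    power_tensor F (quantum_exterior F q n) (m - 1) (map (qext_gen F q n) \<alpha>)"

definition slice_form ::
    "('f, 'c) ring_scheme \<Rightarrow> 'f \<Rightarrow> ('f, 'r, 'd) module_scheme \<Rightarrow> nat \<Rightarrow> nat \<Rightarrow> (nat list \<Rightarrow> 'r)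
      \<Rightarrow> nat \<Rightarrow> nat \<Rightarrow> ('r \<times> ((nat list \<Rightarrow> 'f) set list \<Rightarrow> 'f) set \<Rightarrow> 'f) set"
  where "slice_form F q R m n a k i =
    (\<Oplus>\<^bsub>tensor_space F q R m n\<^esub>\<alpha> \<in> multi_indices n (m - 1).
      pure_tensor F R (tensor_power F (quantum_exterior F q n) (m - 1))
        (slice a k i \<alpha>) (gen_tensor F q m n \<alpha>))"

section \<open>Sums over splittings of a product of two-element sets\<close>

text \<open>A product \<open>J = I\<^sub>1 \<times> \<dots> \<times> I\<^sub>r\<close> is represented by the list of its factors.\<close>

definition pair_boxes :: "nat \<Rightarrow> nat \<Rightarrow> nat set list set"
  where "pair_boxes n r = {J. length J = r \<and> (\<forall>I \<in> set J. I \<subseteq> {1..n} \<and> card I = 2)}"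

definition splittings :: "nat set list \<Rightarrow> (nat list \<times> nat list) set"
  where "splittings J = {(\<alpha>, \<beta>). length \<alpha> = length J \<and> length \<beta> = length J \<and>
    (\<forall>s < length J. {\<alpha> ! s, \<beta> ! s} = J ! s)}"

definition inv_count :: "nat list \<Rightarrow> nat list \<Rightarrow> nat"
  where "inv_count \<alpha> \<beta> = card {s. s < length \<alpha> \<and> \<alpha> ! s > \<beta> ! s}"

definition splitting_sum ::
    "('f, 'c) ring_scheme \<Rightarrow> 'f \<Rightarrow> ('f, 'r, 'd) module_scheme \<Rightarrow> (nat list \<Rightarrow> 'r) \<Rightarrow> nat
      \<Rightarrow> nat set list \<Rightarrow> nat \<Rightarrow> nat \<Rightarrow> 'r"
  where "splitting_sum F q R a k J i j =
    (\<Oplus>\<^bsub>R\<^esub>p \<in> splittings J.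
      ((\<ominus>\<^bsub>F\<^esub> q) [^]\<^bsub>F\<^esub> inv_count (fst p) (snd p)) \<odot>\<^bsub>R\<^esub>
        (slice a k i (fst p) \<otimes>\<^bsub>R\<^esub> slice a k j (snd p)))"

section \<open>The constructions yield associative algebras\<close>

text \<open>
  The library defines \<^const>\<open>genideal\<close> as an intersection over all ideals, which is meaningful
  only when the underlying structure is a ring. The following facts establish this for the
  monoid algebras above, and that all quotients taken are associative algebras.
\<close>

lemma (in abelian_monoid) finsum_swap:
  assumes "finite A" "finite B" "\<And>a b. a \<in> A \<Longrightarrow> b \<in> B \<Longrightarrow> f a b \<in> carrier G"
  shows "(\<Oplus>a\<in>A. \<Oplus>b\<in>B. f a b) = (\<Oplus>b\<in>B. \<Oplus>a\<in>A. f a b)"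
  using assms(1,3)
proof (induction A rule: finite_induct)
  case empty
  then show ?case by simp
next
  case (insert a A)
  have c: "(\<lambda>a. \<Oplus>b\<in>B. f a b) \<in> A \<rightarrow> carrier G" "(\<Oplus>b\<in>B. f a b) \<in> carrier G"
    using insert.prems by (auto intro!: finsum_closed)
  have "(\<Oplus>a\<in>insert a A. \<Oplus>b\<in>B. f a b) = (\<Oplus>b\<in>B. f a b) \<oplus> (\<Oplus>b\<in>B. \<Oplus>a\<in>A. f a b)"
    using insert c by (simp add: finsum_insert)
  also have "\<dots> = (\<Oplus>b\<in>B. f a b \<oplus> (\<Oplus>a\<in>A. f a b))"
    using insert.prems by (intro finsum_addf[symmetric]) (auto intro!: finsum_closed)
  also have "\<dots> = (\<Oplus>b\<in>B. \<Oplus>a\<in>insert a A. f a b)"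
    using insert by (intro finsum_cong') (auto simp: finsum_insert intro!: finsum_closed)
  finally show ?case .
qed

lemma (in abelian_monoid) finsum_cartesian:
  assumes "finite A" "finite B" "\<And>a b. a \<in> A \<Longrightarrow> b \<in> B \<Longrightarrow> f (a, b) \<in> carrier G"
  shows "(\<Oplus>p\<in>A \<times> B. f p) = (\<Oplus>a\<in>A. \<Oplus>b\<in>B. f (a, b))"
  using assms(1,3)
proof (induction A rule: finite_induct)
  case empty
  then show ?case by simp
next
  case (insert a A)
  have c: "(\<lambda>a. \<Oplus>b\<in>B. f (a, b)) \<in> A \<rightarrow> carrier G" "(\<Oplus>b\<in>B. f (a, b)) \<in> carrier G"
    using insert.prems by (auto intro!: finsum_closed)
  have e: "insert a A \<times> B = Pair a ` B \<union> A \<times> B" by auto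
  have "(\<Oplus>p\<in>insert a A \<times> B. f p) = (\<Oplus>p\<in>Pair a ` B. f p) \<oplus> (\<Oplus>p\<in>A \<times> B. f p)"
    unfolding e using insert assms(2) by (intro finsum_Un_disjoint) auto
  also have "(\<Oplus>p\<in>Pair a ` B. f p) = (\<Oplus>b\<in>B. f (a, b))"
    using insert.prems by (intro finsum_reindex) (auto simp: inj_on_def)
  finally show ?case using insert c by (simp add: finsum_insert)
qed

lemma (in abelian_monoid) finsum_delta:
  assumes "finite A" "c \<in> carrier G"
  shows "(\<Oplus>x\<in>A. if x = a then c else \<zero>) = (if a \<in> A then c else \<zero>)"
proof (cases "a \<in> A")
  case True
  then show ?thesis using finsum_singleton[OF True assms(1), of "\<lambda>_. c"] assms
    by (simp add: Pi_def eq_commute)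
next
  case False
  then have "(\<Oplus>x\<in>A. if x = a then c else \<zero>) = (\<Oplus>x\<in>A. \<zero>)"
    by (intro finsum_cong') auto
  then show ?thesis using False by simp
qed

context
  fixes F :: "('f, 'c) ring_scheme" (structure) and M :: "('m, 'd) monoid_scheme"
  assumes F: "cring F" and M: "monoid M"
begin

interpretation F: cring F by (fact F)
interpretation M: monoid M by (fact M)

lemma ma_carrier:
  "f \<in> carrier (monoid_algebra F M) \<longleftrightarrow> finite {u. f u \<noteq> \<zero>} \<and> {u. f u \<noteq> \<zero>} \<subseteq> carrier M \<and> (\<forall>u. f u \<in> carrier F)"
  by (auto simp: monoid_algebra_def)

lemma ma_simps:
  "\<one>\<^bsub>monoid_algebra F M\<^esub> = basis_elt F \<one>\<^bsub>M\<^esub>"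
  "\<zero>\<^bsub>monoid_algebra F M\<^esub> = (\<lambda>w. \<zero>)"
  "f \<oplus>\<^bsub>monoid_algebra F M\<^esub> g = (\<lambda>w. f w \<oplus> g w)"
  "c \<odot>\<^bsub>monoid_algebra F M\<^esub> f = (\<lambda>w. c \<otimes> f w)"
  by (simp_all add: monoid_algebra_def basis_elt_def)

lemma ma_mult:
  assumes f: "f \<in> carrier (monoid_algebra F M)" and g: "g \<in> carrier (monoid_algebra F M)"
    and U: "finite U" "{u. f u \<noteq> \<zero>} \<subseteq> U" and V: "finite V" "{u. g u \<noteq> \<zero>} \<subseteq> V"
  shows "(f \<otimes>\<^bsub>monoid_algebra F M\<^esub> g) w =
    (\<Oplus>u\<in>U. \<Oplus>v\<in>V. if u \<otimes>\<^bsub>M\<^esub> v = w then f u \<otimes> g v else \<zero>)"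
proof -
  have c: "f u \<in> carrier F" "g u \<in> carrier F" for u using f g by (auto simp: ma_carrier)
  let ?D = "{(u, v). f u \<noteq> \<zero> \<and> g v \<noteq> \<zero> \<and> u \<otimes>\<^bsub>M\<^esub> v = w}"
  have D: "?D \<subseteq> U \<times> V" using U V by auto
  have "(f \<otimes>\<^bsub>monoid_algebra F M\<^esub> g) w = (\<Oplus>p\<in>?D. f (fst p) \<otimes> g (snd p))"
    by (simp add: monoid_algebra_def)
  also have "\<dots> = (\<Oplus>p\<in>U \<times> V. if fst p \<otimes>\<^bsub>M\<^esub> snd p = w then f (fst p) \<otimes> g (snd p) else \<zero>)"
    by (rule F.add.finprod_mono_neutral_cong_left) (use U V D c in \<open>auto\<close>)
  also have "\<dots> = (\<Oplus>u\<in>U. \<Oplus>v\<in>V. if u \<otimes>\<^bsub>M\<^esub> v = w then f u \<otimes> g v else \<zero>)"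
    using U V c by (subst F.finsum_cartesian) (auto cong: if_cong)
  finally show ?thesis .
qed

lemma basis_elt_closed: "u \<in> carrier M \<Longrightarrow> basis_elt F u \<in> carrier (monoid_algebra F M)"
proof -
  assume "u \<in> carrier M"
  moreover have "{w. basis_elt F u w \<noteq> \<zero>} \<subseteq> {u}" by (auto simp: basis_elt_def)
  moreover from this have "finite {w. basis_elt F u w \<noteq> \<zero>}" by (rule finite_subset) simp
  ultimately show ?thesis by (auto simp: ma_carrier basis_elt_def)
qed

lemma ma_mult_closed:
  assumes f: "f \<in> carrier (monoid_algebra F M)" and g: "g \<in> carrier (monoid_algebra F M)"
  shows "f \<otimes>\<^bsub>monoid_algebra F M\<^esub> g \<in> carrier (monoid_algebra F M)" (is "?h \<in> _")
    and "{w. (f \<otimes>\<^bsub>monoid_algebra F M\<^esub> g) w \<noteq> \<zero>} \<subseteq>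
      (\<lambda>(u, v). u \<otimes>\<^bsub>M\<^esub> v) ` ({u. f u \<noteq> \<zero>} \<times> {u. g u \<noteq> \<zero>})"
proof -
  let ?U = "{u. f u \<noteq> \<zero>}" and ?V = "{u. g u \<noteq> \<zero>}"
  have c: "f u \<in> carrier F" "g u \<in> carrier F" for u using f g by (auto simp: ma_carrier)
  have fin: "finite ?U" "finite ?V" "?U \<subseteq> carrier M" "?V \<subseteq> carrier M"
    using f g by (auto simp: ma_carrier)
  note m = ma_mult[OF f g fin(1) order_refl fin(2) order_refl]
  have z: "?h w = \<zero>" if "w \<notin> (\<lambda>(u, v). u \<otimes>\<^bsub>M\<^esub> v) ` (?U \<times> ?V)" for w
  proof -
    have "?h w = (\<Oplus>u\<in>?U. \<Oplus>v\<in>?V. \<zero>)" unfolding m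
      by (intro F.finsum_cong' refl) (use that c in \<open>auto intro!: F.finsum_cong'\<close>)
    then show ?thesis by simp
  qed
  then show s: "{w. ?h w \<noteq> \<zero>} \<subseteq> (\<lambda>(u, v). u \<otimes>\<^bsub>M\<^esub> v) ` (?U \<times> ?V)" by blast
  have "finite {w. ?h w \<noteq> \<zero>}" using s by (rule finite_subset) (use fin in auto)
  moreover have "{w. ?h w \<noteq> \<zero>} \<subseteq> carrier M" using s fin by (fastforce intro: M.m_closed)
  moreover have "?h w \<in> carrier F" for w unfolding m
    using c by (auto intro!: F.finsum_closed)
  ultimately show "?h \<in> carrier (monoid_algebra F M)" by (simp add: ma_carrier)
qed

lemma ma_add_closed:
  assumes f: "f \<in> carrier (monoid_algebra F M)" and g: "g \<in> carrier (monoid_algebra F M)"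
  shows "f \<oplus>\<^bsub>monoid_algebra F M\<^esub> g \<in> carrier (monoid_algebra F M)"
proof -
  have s: "{w. f w \<oplus> g w \<noteq> \<zero>} \<subseteq> {u. f u \<noteq> \<zero>} \<union> {u. g u \<noteq> \<zero>}" by auto
  have "finite {w. f w \<oplus> g w \<noteq> \<zero>}" using s by (rule finite_subset) (use f g in \<open>auto simp: ma_carrier\<close>)
  then show ?thesis using f g s by (auto simp: ma_simps ma_carrier)
qed

lemma ma_smult_closed:
  assumes f: "f \<in> carrier (monoid_algebra F M)" and c: "c \<in> carrier F"
  shows "c \<odot>\<^bsub>monoid_algebra F M\<^esub> f \<in> carrier (monoid_algebra F M)"
proof -
  have s: "{w. c \<otimes> f w \<noteq> \<zero>} \<subseteq> {u. f u \<noteq> \<zero>}" using c by auto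
  have "finite {w. c \<otimes> f w \<noteq> \<zero>}" using s by (rule finite_subset) (use f in \<open>auto simp: ma_carrier\<close>)
  then show ?thesis using f s c by (auto simp: ma_simps ma_carrier)
qed

lemma ma_assoc:
  assumes f: "f \<in> carrier (monoid_algebra F M)" and g: "g \<in> carrier (monoid_algebra F M)"
    and h: "h \<in> carrier (monoid_algebra F M)"
  shows "f \<otimes>\<^bsub>monoid_algebra F M\<^esub> g \<otimes>\<^bsub>monoid_algebra F M\<^esub> h =
         f \<otimes>\<^bsub>monoid_algebra F M\<^esub> (g \<otimes>\<^bsub>monoid_algebra F M\<^esub> h)"
proof
  fix w
  let ?T = "monoid_algebra F M"
  define U V W where "U = {u. f u \<noteq> \<zero>}" "V = {u. g u \<noteq> \<zero>}" "W = {u. h u \<noteq> \<zero>}"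
  define P where "P = (\<lambda>(u, v). u \<otimes>\<^bsub>M\<^esub> v) ` (U \<times> V)"
  define Q where "Q = (\<lambda>(u, v). u \<otimes>\<^bsub>M\<^esub> v) ` (V \<times> W)"
  note UVW = U_V_W_def
  have c: "f u \<in> carrier F" "g u \<in> carrier F" "h u \<in> carrier F" for u
    using f g h by (auto simp: ma_carrier)
  have fin: "finite U" "finite V" "finite W" "U \<subseteq> carrier M" "V \<subseteq> carrier M" "W \<subseteq> carrier M"
    using f g h by (auto simp: ma_carrier UVW)
  have finPQ: "finite P" "finite Q" using fin by (auto simp: P_def Q_def)
  have fg: "(f \<otimes>\<^bsub>?T\<^esub> g) t = (\<Oplus>u\<in>U. \<Oplus>v\<in>V. if u \<otimes>\<^bsub>M\<^esub> v = t then f u \<otimes> g v else \<zero>)" for t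
    by (rule ma_mult) (use f g fin UVW in auto)
  have gh: "(g \<otimes>\<^bsub>?T\<^esub> h) t = (\<Oplus>v\<in>V. \<Oplus>z\<in>W. if v \<otimes>\<^bsub>M\<^esub> z = t then g v \<otimes> h z else \<zero>)" for t
    by (rule ma_mult) (use g h fin UVW in auto)
  let ?k = "\<lambda>u v z. if u \<otimes>\<^bsub>M\<^esub> v \<otimes>\<^bsub>M\<^esub> z = w then f u \<otimes> g v \<otimes> h z else \<zero>"
  have "(f \<otimes>\<^bsub>?T\<^esub> g \<otimes>\<^bsub>?T\<^esub> h) w =
      (\<Oplus>t\<in>P. \<Oplus>z\<in>W. if t \<otimes>\<^bsub>M\<^esub> z = w then (f \<otimes>\<^bsub>?T\<^esub> g) t \<otimes> h z else \<zero>)"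
    by (rule ma_mult) (use ma_mult_closed[OF f g] h fin finPQ UVW P_def in auto)
  also have "\<dots> = (\<Oplus>t\<in>P. \<Oplus>z\<in>W. \<Oplus>u\<in>U. \<Oplus>v\<in>V. if u \<otimes>\<^bsub>M\<^esub> v = t then ?k u v z else \<zero>)"
  proof (intro F.finsum_cong' refl)
    fix t z
    show "(if t \<otimes>\<^bsub>M\<^esub> z = w then (f \<otimes>\<^bsub>?T\<^esub> g) t \<otimes> h z else \<zero>) =
       (\<Oplus>u\<in>U. \<Oplus>v\<in>V. if u \<otimes>\<^bsub>M\<^esub> v = t then ?k u v z else \<zero>)"
    proof (cases "t \<otimes>\<^bsub>M\<^esub> z = w")
      case True
      have "(f \<otimes>\<^bsub>?T\<^esub> g) t \<otimes> h z = (\<Oplus>u\<in>U. (\<Oplus>v\<in>V. if u \<otimes>\<^bsub>M\<^esub> v = t then f u \<otimes> g v else \<zero>) \<otimes> h z)"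
        unfolding fg using fin c by (intro F.finsum_ldistr) (auto intro!: F.finsum_closed)
      also have "\<dots> = (\<Oplus>u\<in>U. \<Oplus>v\<in>V. (if u \<otimes>\<^bsub>M\<^esub> v = t then f u \<otimes> g v else \<zero>) \<otimes> h z)"
        using fin c by (intro F.finsum_cong' F.finsum_ldistr refl) (auto intro!: F.finsum_closed)
      also have "\<dots> = (\<Oplus>u\<in>U. \<Oplus>v\<in>V. if u \<otimes>\<^bsub>M\<^esub> v = t then ?k u v z else \<zero>)"
        using fin c True by (intro F.finsum_cong' refl) (auto intro!: F.finsum_closed)
      finally show ?thesis using True by simp
    next
      case False
      have "(\<Oplus>u\<in>U. \<Oplus>v\<in>V. if u \<otimes>\<^bsub>M\<^esub> v = t then ?k u v z else \<zero>) = (\<Oplus>u\<in>U. \<Oplus>v\<in>V. \<zero>)"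
        using fin c False by (intro F.finsum_cong' refl) (auto intro!: F.finsum_closed)
      then show ?thesis using False by simp
    qed
  qed (use c in \<open>auto intro!: F.finsum_closed\<close>)
  also have "\<dots> = (\<Oplus>z\<in>W. \<Oplus>t\<in>P. \<Oplus>u\<in>U. \<Oplus>v\<in>V. if u \<otimes>\<^bsub>M\<^esub> v = t then ?k u v z else \<zero>)"
    by (rule F.finsum_swap) (use c fin finPQ in \<open>auto intro!: F.finsum_closed\<close>)
  also have "\<dots> = (\<Oplus>z\<in>W. \<Oplus>u\<in>U. \<Oplus>t\<in>P. \<Oplus>v\<in>V. if u \<otimes>\<^bsub>M\<^esub> v = t then ?k u v z else \<zero>)"
    by (intro F.finsum_cong' refl F.finsum_swap) (use c fin finPQ in \<open>auto intro!: F.finsum_closed\<close>)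
  also have "\<dots> = (\<Oplus>z\<in>W. \<Oplus>u\<in>U. \<Oplus>v\<in>V. \<Oplus>t\<in>P. if u \<otimes>\<^bsub>M\<^esub> v = t then ?k u v z else \<zero>)"
    by (intro F.finsum_cong' refl F.finsum_swap) (use c fin finPQ in \<open>auto intro!: F.finsum_closed\<close>)
  also have "\<dots> = (\<Oplus>z\<in>W. \<Oplus>u\<in>U. \<Oplus>v\<in>V. ?k u v z)"
  proof (intro F.finsum_cong' refl)
    fix z u v assume "u \<in> U" "v \<in> V"
    then have "u \<otimes>\<^bsub>M\<^esub> v \<in> P" by (auto simp: P_def)
    then show "(\<Oplus>t\<in>P. if u \<otimes>\<^bsub>M\<^esub> v = t then ?k u v z else \<zero>) = ?k u v z"
      using F.finsum_delta[OF finPQ(1), of "?k u v z" "u \<otimes>\<^bsub>M\<^esub> v"] c by (simp add: eq_commute[of _ "u \<otimes>\<^bsub>M\<^esub> v"])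
  qed (use c in \<open>auto intro!: F.finsum_closed\<close>)
  also have "\<dots> = (\<Oplus>u\<in>U. \<Oplus>z\<in>W. \<Oplus>v\<in>V. ?k u v z)"
    by (rule F.finsum_swap) (use c fin finPQ in \<open>auto intro!: F.finsum_closed\<close>)
  also have "\<dots> = (\<Oplus>u\<in>U. \<Oplus>v\<in>V. \<Oplus>z\<in>W. ?k u v z)"
    by (intro F.finsum_cong' refl F.finsum_swap) (use c fin finPQ in \<open>auto intro!: F.finsum_closed\<close>)
  finally have L: "(f \<otimes>\<^bsub>?T\<^esub> g \<otimes>\<^bsub>?T\<^esub> h) w = (\<Oplus>u\<in>U. \<Oplus>v\<in>V. \<Oplus>z\<in>W. ?k u v z)" .
  have "(f \<otimes>\<^bsub>?T\<^esub> (g \<otimes>\<^bsub>?T\<^esub> h)) w =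
      (\<Oplus>u\<in>U. \<Oplus>t\<in>Q. if u \<otimes>\<^bsub>M\<^esub> t = w then f u \<otimes> (g \<otimes>\<^bsub>?T\<^esub> h) t else \<zero>)"
    by (rule ma_mult) (use ma_mult_closed[OF g h] f fin finPQ UVW Q_def in auto)
  also have "\<dots> = (\<Oplus>u\<in>U. \<Oplus>t\<in>Q. \<Oplus>v\<in>V. \<Oplus>z\<in>W. if v \<otimes>\<^bsub>M\<^esub> z = t then ?k u v z else \<zero>)"
  proof (intro F.finsum_cong' refl)
    fix u t assume u: "u \<in> U"
    have as: "u \<otimes>\<^bsub>M\<^esub> (v \<otimes>\<^bsub>M\<^esub> z) = u \<otimes>\<^bsub>M\<^esub> v \<otimes>\<^bsub>M\<^esub> z" if "v \<in> V" "z \<in> W" for v z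
      using u that fin by (intro M.m_assoc[symmetric]) auto
    show "(if u \<otimes>\<^bsub>M\<^esub> t = w then f u \<otimes> (g \<otimes>\<^bsub>?T\<^esub> h) t else \<zero>) =
       (\<Oplus>v\<in>V. \<Oplus>z\<in>W. if v \<otimes>\<^bsub>M\<^esub> z = t then ?k u v z else \<zero>)"
    proof (cases "u \<otimes>\<^bsub>M\<^esub> t = w")
      case True
      have "f u \<otimes> (g \<otimes>\<^bsub>?T\<^esub> h) t = (\<Oplus>v\<in>V. f u \<otimes> (\<Oplus>z\<in>W. if v \<otimes>\<^bsub>M\<^esub> z = t then g v \<otimes> h z else \<zero>))"
        unfolding gh using fin c by (intro F.finsum_rdistr) (auto intro!: F.finsum_closed)
      also have "\<dots> = (\<Oplus>v\<in>V. \<Oplus>z\<in>W. f u \<otimes> (if v \<otimes>\<^bsub>M\<^esub> z = t then g v \<otimes> h z else \<zero>))"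
        using fin c by (intro F.finsum_cong' F.finsum_rdistr refl) (auto intro!: F.finsum_closed)
      also have "\<dots> = (\<Oplus>v\<in>V. \<Oplus>z\<in>W. if v \<otimes>\<^bsub>M\<^esub> z = t then ?k u v z else \<zero>)"
        using fin c True as by (intro F.finsum_cong' refl) (auto intro!: F.finsum_closed simp: F.m_assoc)
      finally show ?thesis using True by simp
    next
      case False
      have "(\<Oplus>v\<in>V. \<Oplus>z\<in>W. if v \<otimes>\<^bsub>M\<^esub> z = t then ?k u v z else \<zero>) = (\<Oplus>v\<in>V. \<Oplus>z\<in>W. \<zero>)"
        using fin c False as by (intro F.finsum_cong' refl) (auto intro!: F.finsum_closed)
      then show ?thesis using False by simp
    qed
  qed (use c in \<open>auto intro!: F.finsum_closed\<close>)
  also have "\<dots> = (\<Oplus>u\<in>U. \<Oplus>v\<in>V. \<Oplus>t\<in>Q. \<Oplus>z\<in>W. if v \<otimes>\<^bsub>M\<^esub> z = t then ?k u v z else \<zero>)"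
    by (intro F.finsum_cong' refl F.finsum_swap) (use c fin finPQ in \<open>auto intro!: F.finsum_closed\<close>)
  also have "\<dots> = (\<Oplus>u\<in>U. \<Oplus>v\<in>V. \<Oplus>z\<in>W. \<Oplus>t\<in>Q. if v \<otimes>\<^bsub>M\<^esub> z = t then ?k u v z else \<zero>)"
    by (intro F.finsum_cong' refl F.finsum_swap) (use c fin finPQ in \<open>auto intro!: F.finsum_closed\<close>)
  also have "\<dots> = (\<Oplus>u\<in>U. \<Oplus>v\<in>V. \<Oplus>z\<in>W. ?k u v z)"
  proof (intro F.finsum_cong' refl)
    fix u v z assume "v \<in> V" "z \<in> W"
    then have "v \<otimes>\<^bsub>M\<^esub> z \<in> Q" by (auto simp: Q_def)
    then show "(\<Oplus>t\<in>Q. if v \<otimes>\<^bsub>M\<^esub> z = t then ?k u v z else \<zero>) = ?k u v z"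
      using F.finsum_delta[OF finPQ(2), of "?k u v z" "v \<otimes>\<^bsub>M\<^esub> z"] c by (simp add: eq_commute[of _ "v \<otimes>\<^bsub>M\<^esub> z"])
  qed (use c in \<open>auto intro!: F.finsum_closed\<close>)
  finally show "(f \<otimes>\<^bsub>?T\<^esub> g \<otimes>\<^bsub>?T\<^esub> h) w = (f \<otimes>\<^bsub>?T\<^esub> (g \<otimes>\<^bsub>?T\<^esub> h)) w"
    using L by simp
qed

lemma ma_basis_mult:
  assumes u: "u \<in> carrier M" and v: "v \<in> carrier M"
  shows "basis_elt F u \<otimes>\<^bsub>monoid_algebra F M\<^esub> basis_elt F v = basis_elt F (u \<otimes>\<^bsub>M\<^esub> v)"
proof
  fix w
  have "(basis_elt F u \<otimes>\<^bsub>monoid_algebra F M\<^esub> basis_elt F v) w =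
    (\<Oplus>u'\<in>{u}. \<Oplus>v'\<in>{v}. if u' \<otimes>\<^bsub>M\<^esub> v' = w then basis_elt F u u' \<otimes> basis_elt F v v' else \<zero>)"
    by (rule ma_mult) (auto simp: basis_elt_closed u v, auto simp: basis_elt_def split: if_splits)
  then show "(basis_elt F u \<otimes>\<^bsub>monoid_algebra F M\<^esub> basis_elt F v) w = basis_elt F (u \<otimes>\<^bsub>M\<^esub> v) w"
    by (auto simp: F.finsum_insert basis_elt_def)
qed

lemma ma_one_l:
  assumes f: "f \<in> carrier (monoid_algebra F M)"
  shows "\<one>\<^bsub>monoid_algebra F M\<^esub> \<otimes>\<^bsub>monoid_algebra F M\<^esub> f = f"
proof
  fix w
  have c: "f u \<in> carrier F" "f u \<noteq> \<zero> \<Longrightarrow> u \<in> carrier M" "finite {u. f u \<noteq> \<zero>}" for u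
    using f by (auto simp: ma_carrier)
  have "(basis_elt F \<one>\<^bsub>M\<^esub> \<otimes>\<^bsub>monoid_algebra F M\<^esub> f) w =
    (\<Oplus>u\<in>{\<one>\<^bsub>M\<^esub>}. \<Oplus>v\<in>{u. f u \<noteq> \<zero>}. if u \<otimes>\<^bsub>M\<^esub> v = w then basis_elt F \<one>\<^bsub>M\<^esub> u \<otimes> f v else \<zero>)"
    by (rule ma_mult) (use c f in \<open>auto simp: basis_elt_closed\<close>, auto simp: basis_elt_def split: if_splits)
  also have "\<dots> = (\<Oplus>v\<in>{u. f u \<noteq> \<zero>}. if \<one>\<^bsub>M\<^esub> \<otimes>\<^bsub>M\<^esub> v = w then basis_elt F \<one>\<^bsub>M\<^esub> \<one>\<^bsub>M\<^esub> \<otimes> f v else \<zero>)"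
    using c by (subst F.finsum_insert) (auto simp: basis_elt_def intro!: F.finsum_closed)
  also have "\<dots> = (\<Oplus>v\<in>{u. f u \<noteq> \<zero>}. if v = w then f w else \<zero>)"
    using c by (intro F.finsum_cong' refl) (auto simp: basis_elt_def)
  also have "\<dots> = f w" using c by (subst F.finsum_delta) auto
  finally show "(\<one>\<^bsub>monoid_algebra F M\<^esub> \<otimes>\<^bsub>monoid_algebra F M\<^esub> f) w = f w" by (simp add: ma_simps)
qed

lemma ma_one_r:
  assumes f: "f \<in> carrier (monoid_algebra F M)"
  shows "f \<otimes>\<^bsub>monoid_algebra F M\<^esub> \<one>\<^bsub>monoid_algebra F M\<^esub> = f"
proof
  fix w
  have c: "f u \<in> carrier F" "f u \<noteq> \<zero> \<Longrightarrow> u \<in> carrier M" "finite {u. f u \<noteq> \<zero>}" for u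
    using f by (auto simp: ma_carrier)
  have "(f \<otimes>\<^bsub>monoid_algebra F M\<^esub> basis_elt F \<one>\<^bsub>M\<^esub>) w =
    (\<Oplus>v\<in>{u. f u \<noteq> \<zero>}. \<Oplus>u\<in>{\<one>\<^bsub>M\<^esub>}. if v \<otimes>\<^bsub>M\<^esub> u = w then f v \<otimes> basis_elt F \<one>\<^bsub>M\<^esub> u else \<zero>)"
    by (rule ma_mult) (use c f in \<open>auto simp: basis_elt_closed\<close>, auto simp: basis_elt_def split: if_splits)
  also have "\<dots> = (\<Oplus>v\<in>{u. f u \<noteq> \<zero>}. if v = w then f w else \<zero>)"
    using c by (intro F.finsum_cong' refl) (auto simp: basis_elt_def F.finsum_insert)
  also have "\<dots> = f w" using c by (subst F.finsum_delta) auto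
  finally show "(f \<otimes>\<^bsub>monoid_algebra F M\<^esub> \<one>\<^bsub>monoid_algebra F M\<^esub>) w = f w" by (simp add: ma_simps)
qed

lemma ma_mult':
  assumes f: "f \<in> carrier (monoid_algebra F M)" and g: "g \<in> carrier (monoid_algebra F M)"
    and U: "finite U" "{u. f u \<noteq> \<zero>} \<subseteq> U" and V: "finite V" "{u. g u \<noteq> \<zero>} \<subseteq> V"
  shows "(f \<otimes>\<^bsub>monoid_algebra F M\<^esub> g) w =
    (\<Oplus>p\<in>{p \<in> U \<times> V. fst p \<otimes>\<^bsub>M\<^esub> snd p = w}. f (fst p) \<otimes> g (snd p))"
proof -
  have c: "f u \<in> carrier F" "g u \<in> carrier F" for u using f g by (auto simp: ma_carrier)
  show ?thesis unfolding monoid_algebra_def monoid.simps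
    by (rule F.add.finprod_mono_neutral_cong_left) (use U V c in \<open>auto\<close>)
qed

lemma ma_distr_l:
  assumes f: "f \<in> carrier (monoid_algebra F M)" and g: "g \<in> carrier (monoid_algebra F M)"
    and h: "h \<in> carrier (monoid_algebra F M)"
  shows "(f \<oplus>\<^bsub>monoid_algebra F M\<^esub> g) \<otimes>\<^bsub>monoid_algebra F M\<^esub> h =
    f \<otimes>\<^bsub>monoid_algebra F M\<^esub> h \<oplus>\<^bsub>monoid_algebra F M\<^esub> g \<otimes>\<^bsub>monoid_algebra F M\<^esub> h"
proof
  fix w
  let ?T = "monoid_algebra F M"
  let ?U = "{u. f u \<noteq> \<zero>} \<union> {u. g u \<noteq> \<zero>}" and ?V = "{u. h u \<noteq> \<zero>}"
  let ?D = "{p \<in> ?U \<times> ?V. fst p \<otimes>\<^bsub>M\<^esub> snd p = w}"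
  have c: "f u \<in> carrier F" "g u \<in> carrier F" "h u \<in> carrier F" "finite ?U" "finite ?V" for u
    using f g h by (auto simp: ma_carrier)
  have 1: "((f \<oplus>\<^bsub>?T\<^esub> g) \<otimes>\<^bsub>?T\<^esub> h) w = (\<Oplus>p\<in>?D. (f \<oplus>\<^bsub>?T\<^esub> g) (fst p) \<otimes> h (snd p))"
    by (rule ma_mult'[OF ma_add_closed[OF f g] h]) (use c in \<open>auto simp: ma_simps\<close>)
  have 2: "(f \<otimes>\<^bsub>?T\<^esub> h) w = (\<Oplus>p\<in>?D. f (fst p) \<otimes> h (snd p))"
    by (rule ma_mult'[OF f h]) (use c in auto)
  have 3: "(g \<otimes>\<^bsub>?T\<^esub> h) w = (\<Oplus>p\<in>?D. g (fst p) \<otimes> h (snd p))"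
    by (rule ma_mult'[OF g h]) (use c in auto)
  have "(\<Oplus>p\<in>?D. (f \<oplus>\<^bsub>?T\<^esub> g) (fst p) \<otimes> h (snd p)) =
     (\<Oplus>p\<in>?D. f (fst p) \<otimes> h (snd p) \<oplus> g (fst p) \<otimes> h (snd p))"
    using c by (intro F.finsum_cong' refl) (auto simp: ma_simps F.l_distr)
  also have "\<dots> = (\<Oplus>p\<in>?D. f (fst p) \<otimes> h (snd p)) \<oplus> (\<Oplus>p\<in>?D. g (fst p) \<otimes> h (snd p))"
    using c by (intro F.finsum_addf) auto
  finally show "((f \<oplus>\<^bsub>?T\<^esub> g) \<otimes>\<^bsub>?T\<^esub> h) w = (f \<otimes>\<^bsub>?T\<^esub> h \<oplus>\<^bsub>?T\<^esub> g \<otimes>\<^bsub>?T\<^esub> h) w"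
    unfolding 1 by (simp add: ma_simps(3) 2 3)
qed

lemma ma_distr_r:
  assumes f: "f \<in> carrier (monoid_algebra F M)" and g: "g \<in> carrier (monoid_algebra F M)"
    and h: "h \<in> carrier (monoid_algebra F M)"
  shows "h \<otimes>\<^bsub>monoid_algebra F M\<^esub> (f \<oplus>\<^bsub>monoid_algebra F M\<^esub> g) =
    h \<otimes>\<^bsub>monoid_algebra F M\<^esub> f \<oplus>\<^bsub>monoid_algebra F M\<^esub> h \<otimes>\<^bsub>monoid_algebra F M\<^esub> g"
proof
  fix w
  let ?T = "monoid_algebra F M"
  let ?U = "{u. f u \<noteq> \<zero>} \<union> {u. g u \<noteq> \<zero>}" and ?V = "{u. h u \<noteq> \<zero>}"
  let ?D = "{p \<in> ?V \<times> ?U. fst p \<otimes>\<^bsub>M\<^esub> snd p = w}"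
  have c: "f u \<in> carrier F" "g u \<in> carrier F" "h u \<in> carrier F" "finite ?U" "finite ?V" for u
    using f g h by (auto simp: ma_carrier)
  have 1: "(h \<otimes>\<^bsub>?T\<^esub> (f \<oplus>\<^bsub>?T\<^esub> g)) w = (\<Oplus>p\<in>?D. h (fst p) \<otimes> (f \<oplus>\<^bsub>?T\<^esub> g) (snd p))"
    by (rule ma_mult'[OF h ma_add_closed[OF f g]]) (use c in \<open>auto simp: ma_simps\<close>)
  have 2: "(h \<otimes>\<^bsub>?T\<^esub> f) w = (\<Oplus>p\<in>?D. h (fst p) \<otimes> f (snd p))"
    by (rule ma_mult'[OF h f]) (use c in auto)
  have 3: "(h \<otimes>\<^bsub>?T\<^esub> g) w = (\<Oplus>p\<in>?D. h (fst p) \<otimes> g (snd p))"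
    by (rule ma_mult'[OF h g]) (use c in auto)
  have "(\<Oplus>p\<in>?D. h (fst p) \<otimes> (f \<oplus>\<^bsub>?T\<^esub> g) (snd p)) =
     (\<Oplus>p\<in>?D. h (fst p) \<otimes> f (snd p) \<oplus> h (fst p) \<otimes> g (snd p))"
    using c by (intro F.finsum_cong' refl) (auto simp: ma_simps F.r_distr)
  also have "\<dots> = (\<Oplus>p\<in>?D. h (fst p) \<otimes> f (snd p)) \<oplus> (\<Oplus>p\<in>?D. h (fst p) \<otimes> g (snd p))"
    using c by (intro F.finsum_addf) auto
  finally show "(h \<otimes>\<^bsub>?T\<^esub> (f \<oplus>\<^bsub>?T\<^esub> g)) w = (h \<otimes>\<^bsub>?T\<^esub> f \<oplus>\<^bsub>?T\<^esub> h \<otimes>\<^bsub>?T\<^esub> g) w"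
    unfolding 1 by (simp add: ma_simps(3) 2 3)
qed

lemma ma_smult_mult:
  assumes f: "f \<in> carrier (monoid_algebra F M)" and g: "g \<in> carrier (monoid_algebra F M)"
    and k: "k \<in> carrier F"
  shows "(k \<odot>\<^bsub>monoid_algebra F M\<^esub> f) \<otimes>\<^bsub>monoid_algebra F M\<^esub> g =
      k \<odot>\<^bsub>monoid_algebra F M\<^esub> (f \<otimes>\<^bsub>monoid_algebra F M\<^esub> g)"
    and "f \<otimes>\<^bsub>monoid_algebra F M\<^esub> (k \<odot>\<^bsub>monoid_algebra F M\<^esub> g) =
      k \<odot>\<^bsub>monoid_algebra F M\<^esub> (f \<otimes>\<^bsub>monoid_algebra F M\<^esub> g)"
proof -
  let ?T = "monoid_algebra F M"
  let ?U = "{u. f u \<noteq> \<zero>}" and ?V = "{u. g u \<noteq> \<zero>}"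
  let ?D = "\<lambda>w. {p \<in> ?U \<times> ?V. fst p \<otimes>\<^bsub>M\<^esub> snd p = w}"
  have c: "f u \<in> carrier F" "g u \<in> carrier F" "finite ?U" "finite ?V" for u
    using f g by (auto simp: ma_carrier)
  have D: "finite (?D w)" for w using c by auto
  have 0: "(f \<otimes>\<^bsub>?T\<^esub> g) w = (\<Oplus>p\<in>?D w. f (fst p) \<otimes> g (snd p))" for w
    by (rule ma_mult'[OF f g]) (use c in auto)
  have 1: "((k \<odot>\<^bsub>?T\<^esub> f) \<otimes>\<^bsub>?T\<^esub> g) w = (\<Oplus>p\<in>?D w. (k \<odot>\<^bsub>?T\<^esub> f) (fst p) \<otimes> g (snd p))" for w
    by (rule ma_mult'[OF ma_smult_closed[OF f k] g]) (use c k in \<open>auto simp: ma_simps\<close>)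
  have 2: "(f \<otimes>\<^bsub>?T\<^esub> (k \<odot>\<^bsub>?T\<^esub> g)) w = (\<Oplus>p\<in>?D w. f (fst p) \<otimes> (k \<odot>\<^bsub>?T\<^esub> g) (snd p))" for w
    by (rule ma_mult'[OF f ma_smult_closed[OF g k]]) (use c k in \<open>auto simp: ma_simps\<close>)
  have 3: "k \<otimes> (f \<otimes>\<^bsub>?T\<^esub> g) w = (\<Oplus>p\<in>?D w. k \<otimes> (f (fst p) \<otimes> g (snd p)))" for w
    unfolding 0 using c k D by (intro F.finsum_rdistr) auto
  show "(k \<odot>\<^bsub>?T\<^esub> f) \<otimes>\<^bsub>?T\<^esub> g = k \<odot>\<^bsub>?T\<^esub> (f \<otimes>\<^bsub>?T\<^esub> g)"
    by (rule ext, unfold 1, unfold ma_simps 3, rule F.finsum_cong')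
       (use c k in \<open>auto simp: F.m_assoc\<close>)
  show "f \<otimes>\<^bsub>?T\<^esub> (k \<odot>\<^bsub>?T\<^esub> g) = k \<odot>\<^bsub>?T\<^esub> (f \<otimes>\<^bsub>?T\<^esub> g)"
    by (rule ext, unfold 2, unfold ma_simps 3, rule F.finsum_cong')
       (use c k in \<open>auto simp: F.m_lcomm\<close>)
qed

lemma ma_abelian_group: "abelian_group (monoid_algebra F M)"
proof (rule abelian_groupI)
  fix f assume f: "f \<in> carrier (monoid_algebra F M)"
  then have "(\<ominus> \<one>) \<odot>\<^bsub>monoid_algebra F M\<^esub> f \<in> carrier (monoid_algebra F M)"
    by (intro ma_smult_closed) auto
  moreover have "(\<ominus> \<one>) \<odot>\<^bsub>monoid_algebra F M\<^esub> f \<oplus>\<^bsub>monoid_algebra F M\<^esub> f = \<zero>\<^bsub>monoid_algebra F M\<^esub>"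
    using f by (auto simp: ma_simps ma_carrier F.l_minus F.l_neg)
  ultimately show "\<exists>g\<in>carrier (monoid_algebra F M). g \<oplus>\<^bsub>monoid_algebra F M\<^esub> f = \<zero>\<^bsub>monoid_algebra F M\<^esub>"
    by blast
qed (auto simp: ma_add_closed, auto simp: ma_simps ma_carrier F.a_ac)

lemma monoid_algebra_assoc_algebra: "assoc_algebra F (monoid_algebra F M)"
proof (intro assoc_algebra.intro assoc_algebra_axioms.intro)
  show "module F (monoid_algebra F M)"
  proof (rule moduleI[OF F ma_abelian_group])
  qed (auto simp: ma_smult_closed, auto simp: ma_simps ma_carrier F.l_distr F.r_distr F.m_assoc)
  show "ring (monoid_algebra F M)"
  proof (rule ringI[OF ma_abelian_group monoidI])
  qed (auto simp: ma_mult_closed(1) ma_one_l ma_one_r ma_assoc ma_distr_l ma_distr_r,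
       auto simp: ma_simps basis_elt_closed)
qed (auto simp: ma_smult_mult)

end

context assoc_algebra
begin

lemma ideal_smult_closed:
  assumes "ideal I A" "c \<in> carrier F" "x \<in> I"
  shows "c \<odot>\<^bsub>A\<^esub> x \<in> I"
proof -
  interpret I: ideal I A by fact
  have x: "x \<in> carrier A" using assms(3) by (rule I.a_Hcarr)
  have "(c \<odot>\<^bsub>A\<^esub> \<one>\<^bsub>A\<^esub>) \<otimes>\<^bsub>A\<^esub> x \<in> I" using assms x by (intro I.I_l_closed) auto
  then show ?thesis using assms x by (simp add: smult_mult_l)
qed

lemma quotient_smult:
  assumes I: "ideal I A" and c: "c \<in> carrier F" and x: "x \<in> carrier A"
  shows "c \<odot>\<^bsub>quotient_algebra A I\<^esub> (I +>\<^bsub>A\<^esub> x) = I +>\<^bsub>A\<^esub> (c \<odot>\<^bsub>A\<^esub> x)"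
proof -
  interpret I: ideal I A by fact
  have "I +>\<^bsub>A\<^esub> (c \<odot>\<^bsub>A\<^esub> y) = I +>\<^bsub>A\<^esub> (c \<odot>\<^bsub>A\<^esub> x)" if y: "y \<in> I +>\<^bsub>A\<^esub> x" for y
  proof -
    obtain h where h: "h \<in> I" "y = h \<oplus>\<^bsub>A\<^esub> x" using y by (auto simp: a_r_coset_def r_coset_def)
    have "c \<odot>\<^bsub>A\<^esub> y = (c \<odot>\<^bsub>A\<^esub> h) \<oplus>\<^bsub>A\<^esub> (c \<odot>\<^bsub>A\<^esub> x)"
      using h c x I.a_Hcarr by (simp add: smult_r_distr)
    moreover have "c \<odot>\<^bsub>A\<^esub> h \<in> I" using ideal_smult_closed[OF I c] h by blast
    ultimately have "c \<odot>\<^bsub>A\<^esub> y \<in> I +>\<^bsub>A\<^esub> (c \<odot>\<^bsub>A\<^esub> x)"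
      by (auto simp: a_r_coset_def r_coset_def)
    then show ?thesis by (rule I.a_repr_independence'[symmetric]) (use c x in simp)
  qed
  moreover have "x \<in> I +>\<^bsub>A\<^esub> x" using x by (rule I.a_rcos_self)
  ultimately have "(\<Union>y \<in> I +>\<^bsub>A\<^esub> x. I +>\<^bsub>A\<^esub> (c \<odot>\<^bsub>A\<^esub> y)) = I +>\<^bsub>A\<^esub> (c \<odot>\<^bsub>A\<^esub> x)"
    by blast
  then show ?thesis by (simp add: quotient_algebra_def)
qed

lemma quotient_assoc_algebra:
  assumes I: "ideal I A"
  shows "assoc_algebra F (quotient_algebra A I)"
proof -
  interpret I: ideal I A by fact
  let ?Q = "quotient_algebra A I"
  have rq: "ring (A Quot I)" by (rule I.quotient_is_ring)
  interpret Q: ring "A Quot I" by (rule rq)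
  have eqs: "carrier ?Q = carrier (A Quot I)" "monoid.mult ?Q = monoid.mult (A Quot I)"
    "\<one>\<^bsub>?Q\<^esub> = \<one>\<^bsub>A Quot I\<^esub>" "\<zero>\<^bsub>?Q\<^esub> = \<zero>\<^bsub>A Quot I\<^esub>" "add ?Q = add (A Quot I)"
    by (simp_all add: quotient_algebra_def)
  have ag: "abelian_group ?Q"
    by (rule abelian_groupI; unfold eqs)
       (rule Q.a_closed Q.zero_closed Q.a_assoc Q.a_comm Q.l_zero Q.add.l_inv_ex; assumption)+
  have ring: "ring ?Q"
    by (rule ringI[OF ag monoidI]; unfold eqs)
       (rule Q.m_closed Q.one_closed Q.m_assoc Q.l_one Q.r_one Q.l_distr Q.r_distr; assumption)+
  have car: "C \<in> carrier ?Q \<Longrightarrow> \<exists>x\<in>carrier A. C = I +>\<^bsub>A\<^esub> x" for C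
    by (auto simp: quotient_algebra_def FactRing_simps)
  have cos: "x \<in> carrier A \<Longrightarrow> I +>\<^bsub>A\<^esub> x \<in> carrier ?Q" for x
    by (auto simp: quotient_algebra_def FactRing_simps)
  have add: "(I +>\<^bsub>A\<^esub> x) \<oplus>\<^bsub>?Q\<^esub> (I +>\<^bsub>A\<^esub> y) = I +>\<^bsub>A\<^esub> (x \<oplus>\<^bsub>A\<^esub> y)"
    if "x \<in> carrier A" "y \<in> carrier A" for x y
    using that by (simp add: quotient_algebra_def FactRing_def I.a_rcos_sum)
  have mult: "(I +>\<^bsub>A\<^esub> x) \<otimes>\<^bsub>?Q\<^esub> (I +>\<^bsub>A\<^esub> y) = I +>\<^bsub>A\<^esub> (x \<otimes>\<^bsub>A\<^esub> y)"
    if "x \<in> carrier A" "y \<in> carrier A" for x y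
    using that by (simp add: quotient_algebra_def FactRing_def I.rcoset_mult_add)
  note s = quotient_smult[OF I]
  show ?thesis
  proof (intro assoc_algebra.intro assoc_algebra_axioms.intro)
    show "module F ?Q"
    proof (rule moduleI)
      show "cring F" by (rule R.is_cring)
      show "abelian_group ?Q" by (rule ag)
    next
      fix c C assume "c \<in> carrier F" "C \<in> carrier ?Q"
      then show "c \<odot>\<^bsub>?Q\<^esub> C \<in> carrier ?Q" using car[of C] by (auto simp: s cos)
    next
      fix c d C assume "c \<in> carrier F" "d \<in> carrier F" "C \<in> carrier ?Q"
      then show "(c \<oplus> d) \<odot>\<^bsub>?Q\<^esub> C = c \<odot>\<^bsub>?Q\<^esub> C \<oplus>\<^bsub>?Q\<^esub> d \<odot>\<^bsub>?Q\<^esub> C"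
        using car[of C] by (auto simp: s add smult_l_distr)
    next
      fix c C D assume "c \<in> carrier F" "C \<in> carrier ?Q" "D \<in> carrier ?Q"
      then show "c \<odot>\<^bsub>?Q\<^esub> (C \<oplus>\<^bsub>?Q\<^esub> D) = c \<odot>\<^bsub>?Q\<^esub> C \<oplus>\<^bsub>?Q\<^esub> c \<odot>\<^bsub>?Q\<^esub> D"
        using car[of C] car[of D] by (auto simp: s add smult_r_distr)
    next
      fix c d C assume "c \<in> carrier F" "d \<in> carrier F" "C \<in> carrier ?Q"
      then show "(c \<otimes> d) \<odot>\<^bsub>?Q\<^esub> C = c \<odot>\<^bsub>?Q\<^esub> (d \<odot>\<^bsub>?Q\<^esub> C)"
        using car[of C] by (auto simp: s smult_assoc1)
    next
      fix C assume "C \<in> carrier ?Q"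
      then show "\<one> \<odot>\<^bsub>?Q\<^esub> C = C" using car[of C] by (auto simp: s)
    qed
    show "ring ?Q" by (rule ring)
  next
    fix c C D assume "c \<in> carrier F" "C \<in> carrier ?Q" "D \<in> carrier ?Q"
    then show "(c \<odot>\<^bsub>?Q\<^esub> C) \<otimes>\<^bsub>?Q\<^esub> D = c \<odot>\<^bsub>?Q\<^esub> (C \<otimes>\<^bsub>?Q\<^esub> D)"
      using car[of C] car[of D] by (auto simp: s mult smult_mult_l)
  next
    fix c C D assume "c \<in> carrier F" "C \<in> carrier ?Q" "D \<in> carrier ?Q"
    then show "C \<otimes>\<^bsub>?Q\<^esub> (c \<odot>\<^bsub>?Q\<^esub> D) = c \<odot>\<^bsub>?Q\<^esub> (C \<otimes>\<^bsub>?Q\<^esub> D)"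
      using car[of C] car[of D] by (auto simp: s mult smult_mult_r)
  qed
qed

end

lemma minus_closed_ring: "\<lbrakk>ring T; x \<in> carrier T; y \<in> carrier T\<rbrakk> \<Longrightarrow> x \<ominus>\<^bsub>T\<^esub> y \<in> carrier T"
  by (simp add: abelian_group.minus_closed ring.is_abelian_group)

lemma monoid_free_monoid: "monoid (free_monoid S)"
  by unfold_locales (auto simp: free_monoid_def)

lemma quantum_exterior_assoc_algebra:
  assumes F: "cring F" and q: "q \<in> carrier F"
  shows "assoc_algebra F (quantum_exterior F q n)"
proof -
  interpret F: cring F by fact
  interpret T: assoc_algebra F "free_algebra F n"
    unfolding free_algebra_def by (rule monoid_algebra_assoc_algebra[OF F monoid_free_monoid])
  have b: "1 \<le> i \<Longrightarrow> i \<le> n \<Longrightarrow> basis_elt F [i] \<in> carrier (free_algebra F n)" for i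
    unfolding free_algebra_def
    by (rule basis_elt_closed[OF F monoid_free_monoid]) (simp add: free_monoid_def)
  have "qext_relations F q n \<subseteq> carrier (free_algebra F n)"
    unfolding qext_relations_def Let_def using b q
    by (auto intro!: minus_closed_ring T.A.ring_axioms T.smult_closed T.A.m_closed)
  then have "ideal (qext_ideal F q n) (free_algebra F n)"
    unfolding qext_ideal_def by (rule T.A.genideal_ideal)
  then show ?thesis unfolding quantum_exterior_def by (rule T.quotient_assoc_algebra)
qed

lemma tensor_algebra_assoc_algebra:
  assumes A: "assoc_algebra F A" and B: "assoc_algebra F B"
  shows "assoc_algebra F (tensor_algebra F A B)"
proof -
  interpret A: assoc_algebra F A by fact
  interpret B: assoc_algebra F B by fact
  have F: "cring F" by (rule A.R.is_cring)
  have M: "monoid (A \<times>\<times> B)" by (intro DirProd_monoid A.A.monoid_axioms B.A.monoid_axioms)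
  let ?T = "monoid_algebra F (A \<times>\<times> B)"
  interpret T: assoc_algebra F ?T by (rule monoid_algebra_assoc_algebra[OF F M])
  have b: "x \<in> carrier A \<Longrightarrow> y \<in> carrier B \<Longrightarrow> basis_elt F (x, y) \<in> carrier ?T" for x y
    by (rule basis_elt_closed[OF F M]) simp
  have "tensor_relations F A B \<subseteq> carrier ?T"
    unfolding tensor_relations_def Let_def
    by (auto intro!: minus_closed_ring T.A.ring_axioms T.smult_closed ring.ring_simprules(1)[OF T.A.ring_axioms] b)
  then have "ideal (tensor_ideal F A B) ?T"
    unfolding tensor_ideal_def by (rule T.A.genideal_ideal)
  then show ?thesis unfolding tensor_algebra_def by (rule T.quotient_assoc_algebra)
qed

lemma monoid_list_power_monoid:
  assumes "monoid M"
  shows "monoid (list_power_monoid M r)"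
proof -
  interpret M: monoid M by fact
  have c: "xs \<in> carrier (list_power_monoid M r) \<longleftrightarrow> length xs = r \<and> (\<forall>i<r. xs ! i \<in> carrier M)" for xs
    by (auto simp: list_power_monoid_def set_conv_nth)
  have m: "length (xs \<otimes>\<^bsub>list_power_monoid M r'\<^esub> ys) = min (length xs) (length ys)"
    "i < length xs \<Longrightarrow> i < length ys \<Longrightarrow> (xs \<otimes>\<^bsub>list_power_monoid M r'\<^esub> ys) ! i = xs ! i \<otimes>\<^bsub>M\<^esub> ys ! i"
    "\<one>\<^bsub>list_power_monoid M r'\<^esub> = replicate r' \<one>\<^bsub>M\<^esub>" for xs ys i r'
    by (simp_all add: list_power_monoid_def)
  show ?thesis
    by (rule monoidI) (auto simp: c m M.m_assoc intro!: nth_equalityI)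
qed

lemma tensor_power_assoc_algebra:
  assumes A: "assoc_algebra F A"
  shows "assoc_algebra F (tensor_power F A r)"
proof -
  interpret A: assoc_algebra F A by fact
  have F: "cring F" by (rule A.R.is_cring)
  let ?L = "list_power_monoid A r"
  have M: "monoid ?L" by (intro monoid_list_power_monoid A.A.monoid_axioms)
  let ?T = "monoid_algebra F ?L"
  interpret T: assoc_algebra F ?T by (rule monoid_algebra_assoc_algebra[OF F M])
  have u: "xs \<in> carrier ?L \<Longrightarrow> x \<in> carrier A \<Longrightarrow> basis_elt F (xs[s := x]) \<in> carrier ?T" for xs s x
    using set_update_subset_insert[of xs s x]
    by (intro basis_elt_closed[OF F M]) (auto simp: list_power_monoid_def)
  have "tensor_power_relations F A r \<subseteq> carrier ?T"
    unfolding tensor_power_relations_def Let_def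
    by (auto intro!: minus_closed_ring T.A.ring_axioms T.smult_closed ring.ring_simprules(1)[OF T.A.ring_axioms] u)
  then have "ideal (tensor_power_ideal F A r) ?T"
    unfolding tensor_power_ideal_def by (rule T.A.genideal_ideal)
  then show ?thesis unfolding tensor_power_def by (rule T.quotient_assoc_algebra)
qed

lemma tensor_space_assoc_algebra:
  assumes "assoc_algebra F R" "q \<in> carrier F"
  shows "assoc_algebra F (tensor_space F q R m n)"
proof -
  have "cring F" using assms(1) by (simp add: assoc_algebra_def module_def)
  then show ?thesis unfolding tensor_space_def
    by (intro tensor_algebra_assoc_algebra tensor_power_assoc_algebra
        quantum_exterior_assoc_algebra assms)
qed

end

theory Submission
  imports Defs
begin

text \<open>
  Multiplying out two of the forms and collecting terms gives, in \<open>R \<otimes> \<Lambda>\<^bsup>\<otimes>(m-1)\<^esup>\<close>,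

  \<open>x\<^sub>j x\<^sub>i = (\<Sum>J. S\<^sub>J(j,i) \<otimes> y\<^sub>J)\<close>,

  where \<open>J = I\<^sub>1 \<times> \<dots> \<times> I\<^bsub>m-1\<^esub>\<close> runs through the products of two-element sets, called boxes below,
  \<open>S\<^sub>J(j,i)\<close> is the sum over the splittings of \<open>J\<close> that occurs in (ii), and \<open>y\<^sub>J\<close> is the tensor with
  factors \<open>x\<^bsub>min I\<^esub> \<and> x\<^bsub>max I\<^esub>\<close>. Indeed, a pair \<open>(\<alpha>,\<beta>)\<close> of multi-indices with a common component
  contributes a factor \<open>x\<^sub>b \<and> x\<^sub>b = 0\<close>; any other pair splits exactly one \<open>J\<close>, and sorting
  \<open>x\<^bsub>\<alpha>\<^sub>s\<^esub> \<and> x\<^bsub>\<beta>\<^sub>s\<^esub>\<close> costs a factor \<open>-q\<close> precisely at the inversions. This is \<open>slice_form_mult\<close>, and it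
  shows that (ii) implies (i).

  The converse holds because the coefficients of the \<open>y\<^sub>J\<close> can be read off: there is a linear map from
  \<open>R \<otimes> \<Lambda>\<^bsup>\<otimes>(m-1)\<^esup>\<close> to \<open>R\<close> that sends \<open>r \<otimes> y\<^sub>J\<close> to \<open>r\<close> and kills \<open>r \<otimes> y\<^sub>K\<close> for \<open>K \<noteq> J\<close>
  (\<open>tensor_space_coordinate\<close>). It is assembled from functionals on the factors. The algebra
  \<open>\<Lambda>\<close> and the two tensor constructions are monoid algebras modulo the ideal generated by some relations,
  and linear maps out of them come from one principle, \<open>linear_map_presented_algebra\<close>: a map on the monoid induces a linear map on the
  quotient as soon as its linear extension kills \<open>u g v\<close> for every relation \<open>g\<close> and all monoid elements
  \<open>u\<close>, \<open>v\<close>. This yields the universal properties of the two tensor constructions and, on \<open>\<Lambda>\<close>, the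
  functional that extracts the coefficient of \<open>x\<^sub>a \<and> x\<^sub>b\<close> for \<open>a < b\<close> (\<open>qext_coordinate\<close>).
\<close>

section \<open>Linear maps out of algebras with generators and relations\<close>

locale linear_map = dom: module F V + cod: module F W
  for F :: "('f, 'c) ring_scheme" and V :: "('f, 'a, 'd) module_scheme"
    and W :: "('f, 'b, 'e) module_scheme" +
  fixes h :: "'a \<Rightarrow> 'b"
  assumes map_closed [simp]: "x \<in> carrier V \<Longrightarrow> h x \<in> carrier W"
    and map_add: "\<lbrakk>x \<in> carrier V; y \<in> carrier V\<rbrakk> \<Longrightarrow> h (x \<oplus>\<^bsub>V\<^esub> y) = h x \<oplus>\<^bsub>W\<^esub> h y"
    and map_smult: "\<lbrakk>c \<in> carrier F; x \<in> carrier V\<rbrakk> \<Longrightarrow> h (c \<odot>\<^bsub>V\<^esub> x) = c \<odot>\<^bsub>W\<^esub> h x"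
begin

lemma map_zero: "h \<zero>\<^bsub>V\<^esub> = \<zero>\<^bsub>W\<^esub>"
  using map_smult[of "\<zero>\<^bsub>F\<^esub>" "\<zero>\<^bsub>V\<^esub>"] by simp

lemma map_uminus: "x \<in> carrier V \<Longrightarrow> h (\<ominus>\<^bsub>V\<^esub> x) = \<ominus>\<^bsub>W\<^esub> h x"
  using map_smult[of "\<ominus>\<^bsub>F\<^esub> \<one>\<^bsub>F\<^esub>" x]
  by (simp add: dom.smult_l_minus cod.smult_l_minus)

lemma map_minus:
  "\<lbrakk>x \<in> carrier V; y \<in> carrier V\<rbrakk> \<Longrightarrow> h (x \<ominus>\<^bsub>V\<^esub> y) = h x \<ominus>\<^bsub>W\<^esub> h y"
  by (simp add: a_minus_def map_add map_uminus)

lemma map_finsum: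
  assumes "finite A" "f \<in> A \<rightarrow> carrier V"
  shows "h (\<Oplus>\<^bsub>V\<^esub>i\<in>A. f i) = (\<Oplus>\<^bsub>W\<^esub>i\<in>A. h (f i))"
  using assms
proof (induction A rule: finite_induct)
  case empty
  then show ?case by (simp add: map_zero)
next
  case (insert i A)
  then show ?case
    by (subst dom.M.finsum_insert cod.M.finsum_insert; force simp: map_add dom.M.finsum_closed Pi_def)+
qed

end

text \<open>
  Extends \<open>\<phi>\<close> from the monoid to its monoid algebra. The sum runs over the support of \<open>f\<close>, which
  is finite for elements of the monoid algebra.
\<close>

definition linear_extension ::
    "('f, 'c) ring_scheme \<Rightarrow> ('f, 'a, 'd) module_scheme \<Rightarrow> ('m \<Rightarrow> 'a) \<Rightarrow> ('m \<Rightarrow> 'f) \<Rightarrow> 'a"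
  where "linear_extension F V \<phi> f = (\<Oplus>\<^bsub>V\<^esub>u\<in>{u. f u \<noteq> \<zero>\<^bsub>F\<^esub>}. f u \<odot>\<^bsub>V\<^esub> \<phi> u)"

text \<open>
  The monoid algebra is spanned by the monoid: an element is rebuilt from zero by restoring the
  coefficients on its support one at a time.
\<close>

lemma monoid_algebra_induct [consumes 3, case_names zero add]:
  assumes F: "cring F" and M: "monoid M" and f: "f \<in> carrier (monoid_algebra F M)"
    and zero: "P \<zero>\<^bsub>monoid_algebra F M\<^esub>"
    and add: "\<And>f c u. \<lbrakk>f \<in> carrier (monoid_algebra F M); c \<in> carrier F; u \<in> carrier M; P f\<rbrakk>
      \<Longrightarrow> P (f \<oplus>\<^bsub>monoid_algebra F M\<^esub> c \<odot>\<^bsub>monoid_algebra F M\<^esub> basis_elt F u)"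
  shows "P f"
proof -
  interpret F: cring F by fact
  note car = ma_carrier[OF F M] and ops = ma_simps[OF F M]
  have "P f" if "finite U" "{u. f u \<noteq> \<zero>\<^bsub>F\<^esub>} \<subseteq> U" "f \<in> carrier (monoid_algebra F M)" for U f
    using that
  proof (induction U arbitrary: f rule: finite_induct)
    case empty
    then have "f = \<zero>\<^bsub>monoid_algebra F M\<^esub>" by (auto simp: ops)
    then show ?case using zero by simp
  next
    case (insert u U)
    let ?g = "f(u := \<zero>\<^bsub>F\<^esub>)"
    have "{v. ?g v \<noteq> \<zero>\<^bsub>F\<^esub>} \<subseteq> {v. f v \<noteq> \<zero>\<^bsub>F\<^esub>}" by auto
    then have g: "?g \<in> carrier (monoid_algebra F M)"
      using insert.prems(2) by (auto simp: car intro: finite_subset)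
    have P: "P ?g" by (rule insert.IH[OF _ g]) (use insert.prems(1) in auto)
    show ?case
    proof (cases "f u = \<zero>\<^bsub>F\<^esub>")
      case True
      then show ?thesis using P by (simp add: fun_upd_idem)
    next
      case False
      then have u: "u \<in> carrier M" "f u \<in> carrier F" using insert.prems(2) by (auto simp: car)
      have "f = ?g \<oplus>\<^bsub>monoid_algebra F M\<^esub> f u \<odot>\<^bsub>monoid_algebra F M\<^esub> basis_elt F u"
        using insert.prems(2) by (auto simp: ops car basis_elt_def)
      then show ?thesis using add[OF g u(2,1) P] by simp
    qed
  qed
  moreover have "finite {u. f u \<noteq> \<zero>\<^bsub>F\<^esub>}" using f by (simp add: car)
  ultimately show ?thesis using f by blast
qed

lemma linear_extension_linear_map:
  assumes M: "monoid M" and V: "module F V" and \<phi>: "\<And>u. u \<in> carrier M \<Longrightarrow> \<phi> u \<in> carrier V"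
  shows "linear_map F (monoid_algebra F M) V (linear_extension F V \<phi>)"
    and "u \<in> carrier M \<Longrightarrow> linear_extension F V \<phi> (basis_elt F u) = \<phi> u"
proof -
  interpret V: module F V by fact
  have F: "cring F" by (rule V.R.is_cring)
  interpret T: assoc_algebra F "monoid_algebra F M" by (rule monoid_algebra_assoc_algebra[OF F M])
  note car = ma_carrier[OF F M] and ops = ma_simps[OF F M]
  let ?\<Phi> = "linear_extension F V \<phi>" and ?S = "\<lambda>f. {u. f u \<noteq> \<zero>\<^bsub>F\<^esub>}"
  have eq: "?\<Phi> f = (\<Oplus>\<^bsub>V\<^esub>u\<in>U. f u \<odot>\<^bsub>V\<^esub> \<phi> u)"
    if "f \<in> carrier (monoid_algebra F M)" "finite U" "?S f \<subseteq> U" "U \<subseteq> carrier M" for f U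
    unfolding linear_extension_def
    by (rule V.M.add.finprod_mono_neutral_cong_left) (use that in \<open>auto simp: car \<phi> subset_eq\<close>)
  show "linear_map F (monoid_algebra F M) V ?\<Phi>"
  proof (intro linear_map.intro linear_map_axioms.intro)
    show "module F (monoid_algebra F M)" by (rule T.module_axioms)
    show "module F V" by fact
  next
    fix f assume "f \<in> carrier (monoid_algebra F M)"
    then show "?\<Phi> f \<in> carrier V"
      unfolding linear_extension_def by (intro V.M.finsum_closed) (auto simp: car intro!: \<phi>)
  next
    fix f g assume f: "f \<in> carrier (monoid_algebra F M)" and g: "g \<in> carrier (monoid_algebra F M)"
    let ?U = "?S f \<union> ?S g"
    have U: "finite ?U" "?U \<subseteq> carrier M" using f g by (auto simp: car)
    have \<phi>U: "\<phi> u \<in> carrier V" if "f u \<noteq> \<zero>\<^bsub>F\<^esub> \<or> g u \<noteq> \<zero>\<^bsub>F\<^esub>" for u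
      using U that by (intro \<phi>) auto
    have "?\<Phi> (f \<oplus>\<^bsub>monoid_algebra F M\<^esub> g) = (\<Oplus>\<^bsub>V\<^esub>u\<in>?U. (f u \<oplus>\<^bsub>F\<^esub> g u) \<odot>\<^bsub>V\<^esub> \<phi> u)"
      using U f g by (subst eq[of _ ?U]) (auto simp: ops ma_add_closed[OF F M, unfolded ops])
    also have "\<dots> = (\<Oplus>\<^bsub>V\<^esub>u\<in>?U. f u \<odot>\<^bsub>V\<^esub> \<phi> u \<oplus>\<^bsub>V\<^esub> g u \<odot>\<^bsub>V\<^esub> \<phi> u)"
      using U f g by (intro V.M.finsum_cong') (auto simp: car \<phi>U V.smult_l_distr)
    also have "\<dots> = ?\<Phi> f \<oplus>\<^bsub>V\<^esub> ?\<Phi> g"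
      using U f g by (subst (1 2) eq[of _ ?U]) (auto simp: car intro!: V.M.finsum_addf \<phi>)
    finally show "?\<Phi> (f \<oplus>\<^bsub>monoid_algebra F M\<^esub> g) = ?\<Phi> f \<oplus>\<^bsub>V\<^esub> ?\<Phi> g" .
  next
    fix c f assume c: "c \<in> carrier F" and f: "f \<in> carrier (monoid_algebra F M)"
    have U: "finite (?S f)" "?S f \<subseteq> carrier M" using f by (auto simp: car)
    have \<phi>U: "\<phi> u \<in> carrier V" if "f u \<noteq> \<zero>\<^bsub>F\<^esub>" for u
      using U that by (intro \<phi>) auto
    have "?\<Phi> (c \<odot>\<^bsub>monoid_algebra F M\<^esub> f) = (\<Oplus>\<^bsub>V\<^esub>u\<in>?S f. (c \<otimes>\<^bsub>F\<^esub> f u) \<odot>\<^bsub>V\<^esub> \<phi> u)"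
      using U f c by (subst eq[of _ "?S f"]) (auto simp: ops ma_smult_closed[OF F M, unfolded ops])
    also have "\<dots> = (\<Oplus>\<^bsub>V\<^esub>u\<in>?S f. c \<odot>\<^bsub>V\<^esub> (f u \<odot>\<^bsub>V\<^esub> \<phi> u))"
      using U f c by (intro V.M.finsum_cong') (auto simp: car \<phi>U V.smult_assoc1)
    also have "\<dots> = c \<odot>\<^bsub>V\<^esub> ?\<Phi> f"
      unfolding linear_extension_def
      using U f c by (intro V.finsum_smult_ldistr[symmetric]) (auto simp: car intro!: \<phi>)
    finally show "?\<Phi> (c \<odot>\<^bsub>monoid_algebra F M\<^esub> f) = c \<odot>\<^bsub>V\<^esub> ?\<Phi> f" .
  qed
  assume u: "u \<in> carrier M"
  then have "?\<Phi> (basis_elt F u) = (\<Oplus>\<^bsub>V\<^esub>v\<in>{u}. basis_elt F u v \<odot>\<^bsub>V\<^esub> \<phi> v)"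
    by (intro eq basis_elt_closed[OF F M]) (auto simp: basis_elt_def)
  then show "?\<Phi> (basis_elt F u) = \<phi> u"
    using \<phi>[OF u] by (simp add: V.M.finsum_insert basis_elt_def)
qed

text \<open>
  The elements \<open>f\<close> such that \<open>\<Phi>\<close> kills \<open>u f v\<close> for all monoid elements \<open>u\<close>, \<open>v\<close> form a two-sided
  ideal, because the monoid spans the algebra. If this ideal contains \<open>G\<close>, it contains the ideal
  generated by \<open>G\<close>, and \<open>u = v = 1\<close> gives the claim.
\<close>

lemma linear_map_vanishes_on_genideal:
  assumes M: "monoid M" and \<Phi>: "linear_map F (monoid_algebra F M) V \<Phi>"
    and G: "G \<subseteq> carrier (monoid_algebra F M)"
    and van: "\<And>g u v. \<lbrakk>g \<in> G; u \<in> carrier M; v \<in> carrier M\<rbrakk>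
      \<Longrightarrow> \<Phi> (basis_elt F u \<otimes>\<^bsub>monoid_algebra F M\<^esub> g \<otimes>\<^bsub>monoid_algebra F M\<^esub> basis_elt F v) = \<zero>\<^bsub>V\<^esub>"
    and f: "f \<in> Idl\<^bsub>monoid_algebra F M\<^esub> G"
  shows "\<Phi> f = \<zero>\<^bsub>V\<^esub>"
proof -
  let ?T = "monoid_algebra F M" and ?e = "basis_elt F"
  interpret \<Phi>: linear_map F ?T V \<Phi> by fact
  interpret M: monoid M by fact
  have F: "cring F" by (rule \<Phi>.dom.R.is_cring)
  interpret T: assoc_algebra F ?T by (rule monoid_algebra_assoc_algebra[OF F M])
  have e: "u \<in> carrier M \<Longrightarrow> ?e u \<in> carrier ?T" for u by (rule basis_elt_closed[OF F M])
  note ee = ma_basis_mult[OF F M]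
  define K where "K = {f \<in> carrier ?T. \<forall>u\<in>carrier M. \<forall>v\<in>carrier M. \<Phi> (?e u \<otimes>\<^bsub>?T\<^esub> f \<otimes>\<^bsub>?T\<^esub> ?e v) = \<zero>\<^bsub>V\<^esub>}"
  have K_add: "x \<oplus>\<^bsub>?T\<^esub> y \<in> K" if "x \<in> K" "y \<in> K" for x y
    using that by (simp add: K_def e T.A.r_distr T.A.l_distr \<Phi>.map_add)
  have K_smult: "c \<odot>\<^bsub>?T\<^esub> x \<in> K" if "x \<in> K" "c \<in> carrier F" for x c
    using that by (simp add: K_def e T.smult_mult_l T.smult_mult_r \<Phi>.map_smult)
  have K_zero: "\<zero>\<^bsub>?T\<^esub> \<in> K" by (simp add: K_def e \<Phi>.map_zero)
  have K_left: "?e w \<otimes>\<^bsub>?T\<^esub> x \<in> K" if "x \<in> K" "w \<in> carrier M" for x w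
    using that by (simp add: K_def e ee T.A.m_assoc[symmetric])
  have K_right: "x \<otimes>\<^bsub>?T\<^esub> ?e w \<in> K" if "x \<in> K" "w \<in> carrier M" for x w
  proof -
    have "?e u \<otimes>\<^bsub>?T\<^esub> (x \<otimes>\<^bsub>?T\<^esub> ?e w) \<otimes>\<^bsub>?T\<^esub> ?e v = ?e u \<otimes>\<^bsub>?T\<^esub> x \<otimes>\<^bsub>?T\<^esub> ?e (w \<otimes>\<^bsub>M\<^esub> v)"
      if "u \<in> carrier M" "v \<in> carrier M" for u v
      using that \<open>x \<in> K\<close> \<open>w \<in> carrier M\<close> by (simp add: K_def e ee[symmetric] T.A.m_assoc)
    then show ?thesis using that by (simp add: K_def e)
  qed
  have K_sub: "x \<in> carrier ?T" if "x \<in> K" for x using that by (simp add: K_def)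
  have "ideal K ?T"
  proof (rule idealI[OF T.A.ring_axioms])
    \<comment> \<open>Negation is scaling by \<open>-1\<close>.\<close>
    have "\<ominus>\<^bsub>?T\<^esub> x \<in> K" if "x \<in> K" for x
      using K_smult[OF that, of "\<ominus>\<^bsub>F\<^esub> \<one>\<^bsub>F\<^esub>"] K_sub[OF that] by (simp add: \<Phi>.dom.smult_l_minus)
    then show "subgroup K (add_monoid ?T)"
      using K_add K_zero K_sub by (intro \<Phi>.dom.M.add.subgroupI) (auto simp: a_inv_def)
  next
    fix x y assume x: "x \<in> K" and y: "y \<in> carrier ?T"
    from F M y show "y \<otimes>\<^bsub>?T\<^esub> x \<in> K"
    proof (induction rule: monoid_algebra_induct)
      case (add y c u)
      then show ?case using x K_add K_smult K_left
        by (simp add: T.A.l_distr T.smult_mult_l e K_sub)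
    qed (simp add: x K_sub K_zero)
    from F M y show "x \<otimes>\<^bsub>?T\<^esub> y \<in> K"
    proof (induction rule: monoid_algebra_induct)
      case (add y c u)
      then show ?case using x K_add K_smult K_right
        by (simp add: T.A.r_distr T.smult_mult_r e K_sub)
    qed (simp add: x K_sub K_zero)
  qed
  moreover have "G \<subseteq> K" using G van by (auto simp: K_def)
  ultimately have "f \<in> K" using f T.A.genideal_minimal by blast
  then have "\<Phi> (\<one>\<^bsub>?T\<^esub> \<otimes>\<^bsub>?T\<^esub> f \<otimes>\<^bsub>?T\<^esub> \<one>\<^bsub>?T\<^esub>) = \<zero>\<^bsub>V\<^esub>"
    by (simp add: K_def ma_simps[OF F M])
  then show ?thesis using K_sub[OF \<open>f \<in> K\<close>] by simp
qed

context assoc_algebra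
begin

lemma quotient_carrier: "carrier (quotient_algebra A I) = (\<lambda>x. I +>\<^bsub>A\<^esub> x) ` carrier A"
  by (auto simp: quotient_algebra_def FactRing_simps)

lemma quotient_ops:
  assumes I: "ideal I A" and x: "x \<in> carrier A" and y: "y \<in> carrier A"
  shows "(I +>\<^bsub>A\<^esub> x) \<oplus>\<^bsub>quotient_algebra A I\<^esub> (I +>\<^bsub>A\<^esub> y) = I +>\<^bsub>A\<^esub> (x \<oplus>\<^bsub>A\<^esub> y)"
    and "(I +>\<^bsub>A\<^esub> x) \<otimes>\<^bsub>quotient_algebra A I\<^esub> (I +>\<^bsub>A\<^esub> y) = I +>\<^bsub>A\<^esub> (x \<otimes>\<^bsub>A\<^esub> y)"
proof -
  interpret I: ideal I A by fact
  show "(I +>\<^bsub>A\<^esub> x) \<oplus>\<^bsub>quotient_algebra A I\<^esub> (I +>\<^bsub>A\<^esub> y) = I +>\<^bsub>A\<^esub> (x \<oplus>\<^bsub>A\<^esub> y)"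
    "(I +>\<^bsub>A\<^esub> x) \<otimes>\<^bsub>quotient_algebra A I\<^esub> (I +>\<^bsub>A\<^esub> y) = I +>\<^bsub>A\<^esub> (x \<otimes>\<^bsub>A\<^esub> y)"
    using x y by (simp_all add: quotient_algebra_def FactRing_def I.a_rcos_sum I.rcoset_mult_add)
qed

lemma quotient_zero: "ideal I A \<Longrightarrow> \<zero>\<^bsub>quotient_algebra A I\<^esub> = I +>\<^bsub>A\<^esub> \<zero>\<^bsub>A\<^esub>"
proof -
  assume "ideal I A"
  then interpret I: ideal I A .
  show ?thesis using I.a_subset by (simp add: quotient_algebra_def FactRing_def)
qed

lemma coset_eqI:
  assumes I: "ideal I A" and xy: "x \<ominus>\<^bsub>A\<^esub> y \<in> I" "x \<in> carrier A" "y \<in> carrier A"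
  shows "I +>\<^bsub>A\<^esub> x = I +>\<^bsub>A\<^esub> y"
proof -
  interpret I: ideal I A by fact
  have "x = (x \<ominus>\<^bsub>A\<^esub> y) \<oplus>\<^bsub>A\<^esub> y" using xy by (simp add: a_minus_def M.a_assoc M.l_neg)
  then have "x \<in> I +>\<^bsub>A\<^esub> y" using xy(1) by (auto simp: a_r_coset_def r_coset_def)
  then show ?thesis using xy by (intro I.a_repr_independence'[symmetric])
qed

text \<open>
  The induced map evaluates \<open>\<Phi>\<close> at a representative chosen from the coset; it does not depend on the
  choice because \<open>\<Phi>\<close> vanishes on \<open>I\<close>.
\<close>

lemma linear_map_quotient:
  assumes I: "ideal I A" and \<Phi>: "linear_map F A V \<Phi>" and van: "\<And>x. x \<in> I \<Longrightarrow> \<Phi> x = \<zero>\<^bsub>V\<^esub>"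
  obtains h where "linear_map F (quotient_algebra A I) V h"
    and "\<And>x. x \<in> carrier A \<Longrightarrow> h (I +>\<^bsub>A\<^esub> x) = \<Phi> x"
proof
  interpret I: ideal I A by fact
  interpret \<Phi>: linear_map F A V \<Phi> by fact
  interpret Q: assoc_algebra F "quotient_algebra A I" by (rule quotient_assoc_algebra[OF I])
  define h where "h C = \<Phi> (SOME x. x \<in> C)" for C
  show h: "h (I +>\<^bsub>A\<^esub> x) = \<Phi> x" if x: "x \<in> carrier A" for x
  proof -
    have "(SOME y. y \<in> I +>\<^bsub>A\<^esub> x) \<in> I +>\<^bsub>A\<^esub> x" using I.a_rcos_self[OF x] by (rule someI)
    then obtain z where "z \<in> I" "(SOME y. y \<in> I +>\<^bsub>A\<^esub> x) = z \<oplus>\<^bsub>A\<^esub> x"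
      by (auto simp: a_r_coset_def r_coset_def)
    then show ?thesis using x by (simp add: h_def \<Phi>.map_add I.a_Hcarr van)
  qed
  show "linear_map F (quotient_algebra A I) V h"
    by (intro linear_map.intro linear_map_axioms.intro Q.module_axioms \<Phi>.cod.module_axioms)
       (auto simp: quotient_carrier h quotient_ops[OF I] quotient_smult[OF I] \<Phi>.map_add \<Phi>.map_smult)
qed

end

text \<open>
  Linear maps out of an algebra given by monoid generators and relations. In the hypothesis \<open>van\<close>,
  the map \<open>\<Psi>\<close> stands for \<open>f \<mapsto> \<Phi> (u f v)\<close> with \<open>\<Phi>\<close> the linear extension of \<open>\<phi>\<close>: for the relations
  used below, evaluating \<open>\<Psi>\<close> takes only its linearity and its values on the monoid.
\<close>

lemma linear_map_presented_algebra:
  assumes M: "monoid M" and V: "module F V"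
    and G: "G \<subseteq> carrier (monoid_algebra F M)"
    and \<phi>: "\<And>u. u \<in> carrier M \<Longrightarrow> \<phi> u \<in> carrier V"
    and van: "\<And>\<Psi> g u v. \<lbrakk>linear_map F (monoid_algebra F M) V \<Psi>; u \<in> carrier M; v \<in> carrier M;
        \<And>w. w \<in> carrier M \<Longrightarrow> \<Psi> (basis_elt F w) = \<phi> (u \<otimes>\<^bsub>M\<^esub> w \<otimes>\<^bsub>M\<^esub> v); g \<in> G\<rbrakk>
      \<Longrightarrow> \<Psi> g = \<zero>\<^bsub>V\<^esub>"
  obtains h where "linear_map F (quotient_algebra (monoid_algebra F M) (Idl\<^bsub>monoid_algebra F M\<^esub> G)) V h"
    and "\<And>u. u \<in> carrier M \<Longrightarrow>
      h ((Idl\<^bsub>monoid_algebra F M\<^esub> G) +>\<^bsub>monoid_algebra F M\<^esub> basis_elt F u) = \<phi> u"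
proof -
  let ?T = "monoid_algebra F M" and ?e = "basis_elt F"
  interpret V: module F V by fact
  have F: "cring F" by (rule V.R.is_cring)
  interpret T: assoc_algebra F ?T by (rule monoid_algebra_assoc_algebra[OF F M])
  interpret M: monoid M by fact
  note L = linear_extension_linear_map[OF M V \<phi>]
  interpret \<Phi>: linear_map F ?T V "linear_extension F V \<phi>" by (rule L(1))
  have e: "u \<in> carrier M \<Longrightarrow> ?e u \<in> carrier ?T" for u by (rule basis_elt_closed[OF F M])
  have "linear_extension F V \<phi> (?e u \<otimes>\<^bsub>?T\<^esub> g \<otimes>\<^bsub>?T\<^esub> ?e v) = \<zero>\<^bsub>V\<^esub>"
    if g: "g \<in> G" and uv: "u \<in> carrier M" "v \<in> carrier M" for g u v
  proof (rule van[where \<Psi> = "\<lambda>g. linear_extension F V \<phi> (?e u \<otimes>\<^bsub>?T\<^esub> g \<otimes>\<^bsub>?T\<^esub> ?e v)", OF _ uv _ g])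
    show "linear_map F ?T V (\<lambda>g. linear_extension F V \<phi> (?e u \<otimes>\<^bsub>?T\<^esub> g \<otimes>\<^bsub>?T\<^esub> ?e v))"
      using uv
      by (intro linear_map.intro linear_map_axioms.intro T.module_axioms V)
         (auto simp: e T.A.r_distr T.A.l_distr T.smult_mult_l T.smult_mult_r \<Phi>.map_add \<Phi>.map_smult)
  qed (simp add: uv ma_basis_mult[OF F M] L(2))
  then have van0: "linear_extension F V \<phi> f = \<zero>\<^bsub>V\<^esub>" if "f \<in> Idl\<^bsub>?T\<^esub> G" for f
    using that by (rule linear_map_vanishes_on_genideal[OF M \<Phi>.linear_map_axioms G])
  show ?thesis
  proof (rule T.linear_map_quotient[OF T.A.genideal_ideal[OF G] \<Phi>.linear_map_axioms van0])
    fix h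
    assume "linear_map F (quotient_algebra ?T (Idl\<^bsub>?T\<^esub> G)) V h"
      and "\<And>x. x \<in> carrier ?T \<Longrightarrow> h ((Idl\<^bsub>?T\<^esub> G) +>\<^bsub>?T\<^esub> x) = linear_extension F V \<phi> x"
    then show thesis by (intro that[of h]) (auto simp: L(2) e)
  qed
qed

section \<open>The universal property of the tensor product\<close>

locale bilinear_map = left: module F A + right: module F B + cod: module F V
  for F :: "('f, 'c) ring_scheme" and A :: "('f, 'a, 'd) module_scheme"
    and B :: "('f, 'b, 'e) module_scheme" and V :: "('f, 'v, 'g) module_scheme" +
  fixes \<beta> :: "'a \<Rightarrow> 'b \<Rightarrow> 'v"
  assumes map_closed [simp]: "\<lbrakk>x \<in> carrier A; y \<in> carrier B\<rbrakk> \<Longrightarrow> \<beta> x y \<in> carrier V"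
    and map_add_left: "\<lbrakk>x \<in> carrier A; x' \<in> carrier A; y \<in> carrier B\<rbrakk>
      \<Longrightarrow> \<beta> (x \<oplus>\<^bsub>A\<^esub> x') y = \<beta> x y \<oplus>\<^bsub>V\<^esub> \<beta> x' y"
    and map_add_right: "\<lbrakk>x \<in> carrier A; y \<in> carrier B; y' \<in> carrier B\<rbrakk>
      \<Longrightarrow> \<beta> x (y \<oplus>\<^bsub>B\<^esub> y') = \<beta> x y \<oplus>\<^bsub>V\<^esub> \<beta> x y'"
    and map_smult_left: "\<lbrakk>c \<in> carrier F; x \<in> carrier A; y \<in> carrier B\<rbrakk>
      \<Longrightarrow> \<beta> (c \<odot>\<^bsub>A\<^esub> x) y = c \<odot>\<^bsub>V\<^esub> \<beta> x y"
    and map_smult_right: "\<lbrakk>c \<in> carrier F; x \<in> carrier A; y \<in> carrier B\<rbrakk>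
      \<Longrightarrow> \<beta> x (c \<odot>\<^bsub>B\<^esub> y) = c \<odot>\<^bsub>V\<^esub> \<beta> x y"
begin

lemma linear_left: "y \<in> carrier B \<Longrightarrow> linear_map F A V (\<lambda>x. \<beta> x y)"
  by unfold_locales (simp_all add: map_add_left map_smult_left)

lemma linear_right: "x \<in> carrier A \<Longrightarrow> linear_map F B V (\<beta> x)"
  by unfold_locales (simp_all add: map_add_right map_smult_right)

end

lemma tensor_relations_closed:
  assumes A: "assoc_algebra F A" and B: "assoc_algebra F B"
  shows "tensor_relations F A B \<subseteq> carrier (monoid_algebra F (A \<times>\<times> B))"
proof -
  interpret A: assoc_algebra F A by fact
  interpret B: assoc_algebra F B by fact
  have F: "cring F" by (rule A.R.is_cring)
  have M: "monoid (A \<times>\<times> B)" by (intro DirProd_monoid A.A.monoid_axioms B.A.monoid_axioms)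
  interpret T: assoc_algebra F "monoid_algebra F (A \<times>\<times> B)"
    by (rule monoid_algebra_assoc_algebra[OF F M])
  have b: "x \<in> carrier A \<Longrightarrow> y \<in> carrier B \<Longrightarrow> basis_elt F (x, y) \<in> carrier (monoid_algebra F (A \<times>\<times> B))"
    for x y by (rule basis_elt_closed[OF F M]) simp
  show ?thesis
    unfolding tensor_relations_def Let_def
    by (auto intro!: T.M.minus_closed T.smult_closed T.M.a_closed b)
qed

lemma pure_tensor_bilinear:
  assumes A: "assoc_algebra F A" and B: "assoc_algebra F B"
  shows "bilinear_map F A B (tensor_algebra F A B) (pure_tensor F A B)"
    and "\<lbrakk>x \<in> carrier A; x' \<in> carrier A; y \<in> carrier B; y' \<in> carrier B\<rbrakk> \<Longrightarrow>
      pure_tensor F A B x y \<otimes>\<^bsub>tensor_algebra F A B\<^esub> pure_tensor F A B x' y' =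
      pure_tensor F A B (x \<otimes>\<^bsub>A\<^esub> x') (y \<otimes>\<^bsub>B\<^esub> y')"
proof -
  interpret A: assoc_algebra F A by fact
  interpret B: assoc_algebra F B by fact
  have F: "cring F" by (rule A.R.is_cring)
  have M: "monoid (A \<times>\<times> B)" by (intro DirProd_monoid A.A.monoid_axioms B.A.monoid_axioms)
  let ?T = "monoid_algebra F (A \<times>\<times> B)" and ?Q = "tensor_algebra F A B" and ?I = "tensor_ideal F A B"
  interpret T: assoc_algebra F ?T by (rule monoid_algebra_assoc_algebra[OF F M])
  interpret Q: assoc_algebra F ?Q by (rule tensor_algebra_assoc_algebra[OF A B])
  have I: "ideal ?I ?T" and rel: "tensor_relations F A B \<subseteq> ?I"
    unfolding tensor_ideal_def
    by (rule T.A.genideal_ideal T.A.genideal_self, rule tensor_relations_closed[OF A B])+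
  have b: "x \<in> carrier A \<Longrightarrow> y \<in> carrier B \<Longrightarrow> basis_elt F (x, y) \<in> carrier ?T" for x y
    by (rule basis_elt_closed[OF F M]) simp
  note ops = pure_tensor_def tensor_algebra_def T.quotient_ops[OF I] T.quotient_smult[OF I] b
  show "bilinear_map F A B ?Q (pure_tensor F A B)"
  proof (intro bilinear_map.intro bilinear_map_axioms.intro A.module_axioms B.module_axioms Q.module_axioms)
    fix x y assume "x \<in> carrier A" "y \<in> carrier B"
    then show "pure_tensor F A B x y \<in> carrier ?Q"
      by (simp add: ops T.quotient_carrier)
  next
    fix x x' y assume c: "x \<in> carrier A" "x' \<in> carrier A" "y \<in> carrier B"
    then have "basis_elt F (x \<oplus>\<^bsub>A\<^esub> x', y) \<ominus>\<^bsub>?T\<^esub> (basis_elt F (x, y) \<oplus>\<^bsub>?T\<^esub> basis_elt F (x', y)) \<in> ?I"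
      by (intro subsetD[OF rel]) (fastforce simp: tensor_relations_def Let_def)
    then show "pure_tensor F A B (x \<oplus>\<^bsub>A\<^esub> x') y = pure_tensor F A B x y \<oplus>\<^bsub>?Q\<^esub> pure_tensor F A B x' y"
      using c by (simp add: ops T.coset_eqI[OF I])
  next
    fix x y y' assume c: "x \<in> carrier A" "y \<in> carrier B" "y' \<in> carrier B"
    then have "basis_elt F (x, y \<oplus>\<^bsub>B\<^esub> y') \<ominus>\<^bsub>?T\<^esub> (basis_elt F (x, y) \<oplus>\<^bsub>?T\<^esub> basis_elt F (x, y')) \<in> ?I"
      by (intro subsetD[OF rel]) (fastforce simp: tensor_relations_def Let_def)
    then show "pure_tensor F A B x (y \<oplus>\<^bsub>B\<^esub> y') = pure_tensor F A B x y \<oplus>\<^bsub>?Q\<^esub> pure_tensor F A B x y'"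
      using c by (simp add: ops T.coset_eqI[OF I])
  next
    fix c x y assume c: "c \<in> carrier F" "x \<in> carrier A" "y \<in> carrier B"
    then have "basis_elt F (c \<odot>\<^bsub>A\<^esub> x, y) \<ominus>\<^bsub>?T\<^esub> c \<odot>\<^bsub>?T\<^esub> basis_elt F (x, y) \<in> ?I"
      by (intro subsetD[OF rel]) (fastforce simp: tensor_relations_def Let_def)
    then show "pure_tensor F A B (c \<odot>\<^bsub>A\<^esub> x) y = c \<odot>\<^bsub>?Q\<^esub> pure_tensor F A B x y"
      using c by (simp add: ops T.coset_eqI[OF I])
  next
    fix c x y assume c: "c \<in> carrier F" "x \<in> carrier A" "y \<in> carrier B"
    then have "basis_elt F (x, c \<odot>\<^bsub>B\<^esub> y) \<ominus>\<^bsub>?T\<^esub> c \<odot>\<^bsub>?T\<^esub> basis_elt F (x, y) \<in> ?I"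
      by (intro subsetD[OF rel]) (fastforce simp: tensor_relations_def Let_def)
    then show "pure_tensor F A B x (c \<odot>\<^bsub>B\<^esub> y) = c \<odot>\<^bsub>?Q\<^esub> pure_tensor F A B x y"
      using c by (simp add: ops T.coset_eqI[OF I])
  qed
  assume "x \<in> carrier A" "x' \<in> carrier A" "y \<in> carrier B" "y' \<in> carrier B"
  then show "pure_tensor F A B x y \<otimes>\<^bsub>?Q\<^esub> pure_tensor F A B x' y' =
      pure_tensor F A B (x \<otimes>\<^bsub>A\<^esub> x') (y \<otimes>\<^bsub>B\<^esub> y')"
    by (simp add: ops ma_basis_mult[OF F M])
qed

text \<open>
  Multiplying a bilinearity relation on both sides by pure tensors gives a bilinearity relation
  between the products, and a bilinear map respects it.
\<close>

lemma tensor_algebra_universal: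
  assumes A: "assoc_algebra F A" and B: "assoc_algebra F B" and \<beta>: "bilinear_map F A B V \<beta>"
  obtains h where "linear_map F (tensor_algebra F A B) V h"
    and "\<And>x y. \<lbrakk>x \<in> carrier A; y \<in> carrier B\<rbrakk> \<Longrightarrow> h (pure_tensor F A B x y) = \<beta> x y"
proof -
  interpret A: assoc_algebra F A by fact
  interpret B: assoc_algebra F B by fact
  interpret \<beta>: bilinear_map F A B V \<beta> by fact
  have F: "cring F" by (rule A.R.is_cring)
  have M: "monoid (A \<times>\<times> B)" by (intro DirProd_monoid A.A.monoid_axioms B.A.monoid_axioms)
  let ?T = "monoid_algebra F (A \<times>\<times> B)"
  interpret T: assoc_algebra F ?T by (rule monoid_algebra_assoc_algebra[OF F M])
  have b: "x \<in> carrier A \<Longrightarrow> y \<in> carrier B \<Longrightarrow> basis_elt F (x, y) \<in> carrier ?T" for x y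
    by (rule basis_elt_closed[OF F M]) simp
  show ?thesis
  proof (rule linear_map_presented_algebra[where \<phi> = "\<lambda>(x, y). \<beta> x y",
        OF M \<beta>.cod.module_axioms tensor_relations_closed[OF A B]])
    fix \<Psi> g u v
    assume \<Psi>: "linear_map F ?T V \<Psi>" and u: "u \<in> carrier (A \<times>\<times> B)" and v: "v \<in> carrier (A \<times>\<times> B)"
      and eq: "\<And>w. w \<in> carrier (A \<times>\<times> B) \<Longrightarrow> \<Psi> (basis_elt F w) =
        (case u \<otimes>\<^bsub>A \<times>\<times> B\<^esub> w \<otimes>\<^bsub>A \<times>\<times> B\<^esub> v of (x, y) \<Rightarrow> \<beta> x y)"
      and g: "g \<in> tensor_relations F A B"
    interpret \<Psi>: linear_map F ?T V \<Psi> by fact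
    obtain u1 u2 v1 v2 where uv: "u = (u1, u2)" "v = (v1, v2)" by (cases u; cases v)
    have eq': "\<Psi> (basis_elt F (x, y)) = \<beta> (u1 \<otimes>\<^bsub>A\<^esub> x \<otimes>\<^bsub>A\<^esub> v1) (u2 \<otimes>\<^bsub>B\<^esub> y \<otimes>\<^bsub>B\<^esub> v2)"
      if "x \<in> carrier A" "y \<in> carrier B" for x y
      using eq[of "(x, y)"] that by (simp add: uv)
    have [simp]: "u1 \<in> carrier A" "u2 \<in> carrier B" "v1 \<in> carrier A" "v2 \<in> carrier B"
      using u v by (auto simp: uv)
    have [simp]: "x \<in> carrier V \<Longrightarrow> x \<ominus>\<^bsub>V\<^esub> x = \<zero>\<^bsub>V\<^esub>" for x
      by (simp add: a_minus_def \<beta>.cod.M.r_neg)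
    show "\<Psi> g = \<zero>\<^bsub>V\<^esub>"
      using g unfolding tensor_relations_def Let_def
      by (auto simp: \<Psi>.map_minus \<Psi>.map_add \<Psi>.map_smult b eq' A.A.r_distr A.A.l_distr B.A.r_distr B.A.l_distr
          A.smult_mult_l A.smult_mult_r B.smult_mult_l B.smult_mult_r
          \<beta>.map_add_left \<beta>.map_add_right \<beta>.map_smult_left \<beta>.map_smult_right)
  next
    fix h
    assume "linear_map F (quotient_algebra ?T (Idl\<^bsub>?T\<^esub> tensor_relations F A B)) V h"
      and "\<And>u. u \<in> carrier (A \<times>\<times> B) \<Longrightarrow>
        h ((Idl\<^bsub>?T\<^esub> tensor_relations F A B) +>\<^bsub>?T\<^esub> basis_elt F u) = (case u of (x, y) \<Rightarrow> \<beta> x y)"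
    then show thesis
      by (intro that[of h]) (auto simp: tensor_algebra_def pure_tensor_def tensor_ideal_def)
  qed (auto)
qed

section \<open>The universal property of the tensor power\<close>

lemma list_power_carrier:
  "xs \<in> carrier (list_power_monoid A r) \<longleftrightarrow> length xs = r \<and> set xs \<subseteq> carrier A"
  by (simp add: list_power_monoid_def)

lemma list_power_update:
  "\<lbrakk>xs \<in> carrier (list_power_monoid A r); x \<in> carrier A\<rbrakk>
    \<Longrightarrow> xs[s := x] \<in> carrier (list_power_monoid A r)"
  using set_update_subset_insert[of xs s x] by (auto simp: list_power_carrier)

lemma list_power_nth: "\<lbrakk>xs \<in> carrier (list_power_monoid A r); s < r\<rbrakk> \<Longrightarrow> xs ! s \<in> carrier A"
  by (auto simp: list_power_carrier)

lemma list_power_mult: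
  "xs \<otimes>\<^bsub>list_power_monoid A r\<^esub> ys = map2 (\<lambda>x y. x \<otimes>\<^bsub>A\<^esub> y) xs ys"
  by (simp add: list_power_monoid_def)

text \<open>
  Multiplication by tuples preserves the shape \<open>xs[s := x]\<close> in which the multilinearity relations
  are stated.
\<close>

lemma list_power_mult_update:
  assumes "xs \<in> carrier (list_power_monoid A r)" "us \<in> carrier (list_power_monoid A r)"
    "vs \<in> carrier (list_power_monoid A r)" "s < r"
  shows "us \<otimes>\<^bsub>list_power_monoid A r\<^esub> xs[s := x] \<otimes>\<^bsub>list_power_monoid A r\<^esub> vs =
    (us \<otimes>\<^bsub>list_power_monoid A r\<^esub> xs \<otimes>\<^bsub>list_power_monoid A r\<^esub> vs)[s := us ! s \<otimes>\<^bsub>A\<^esub> x \<otimes>\<^bsub>A\<^esub> vs ! s]"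
  using assms by (intro nth_equalityI) (auto simp: list_power_mult list_power_carrier nth_list_update)

locale multilinear_map = dom: module F A + cod: module F V
  for F :: "('f, 'c) ring_scheme" and A :: "('f, 'a, 'd) module_scheme"
    and V :: "('f, 'v, 'g) module_scheme" +
  fixes r :: nat and \<mu> :: "'a list \<Rightarrow> 'v"
  assumes map_closed [simp]: "xs \<in> carrier (list_power_monoid A r) \<Longrightarrow> \<mu> xs \<in> carrier V"
    and map_add: "\<lbrakk>xs \<in> carrier (list_power_monoid A r); s < r; x \<in> carrier A; y \<in> carrier A\<rbrakk>
      \<Longrightarrow> \<mu> (xs[s := x \<oplus>\<^bsub>A\<^esub> y]) = \<mu> (xs[s := x]) \<oplus>\<^bsub>V\<^esub> \<mu> (xs[s := y])"
    and map_smult: "\<lbrakk>xs \<in> carrier (list_power_monoid A r); s < r; c \<in> carrier F; x \<in> carrier A\<rbrakk>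
      \<Longrightarrow> \<mu> (xs[s := c \<odot>\<^bsub>A\<^esub> x]) = c \<odot>\<^bsub>V\<^esub> \<mu> (xs[s := x])"
begin

text \<open>
  Each slot gives up its scalar separately; the induction runs over the set of slots already
  scaled.
\<close>

lemma map_smult_all:
  assumes xs: "xs \<in> carrier (list_power_monoid A r)" and c: "\<And>s. s < r \<Longrightarrow> c s \<in> carrier F"
  shows "\<mu> (map (\<lambda>s. c s \<odot>\<^bsub>A\<^esub> xs ! s) [0..<r]) = (\<Otimes>\<^bsub>F\<^esub>s\<in>{..<r}. c s) \<odot>\<^bsub>V\<^esub> \<mu> xs"
proof -
  define zs where "zs D = map (\<lambda>s. if s \<in> D then c s \<odot>\<^bsub>A\<^esub> xs ! s else xs ! s) [0..<r]" for D
  have zs: "zs D \<in> carrier (list_power_monoid A r)" for D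
    using c list_power_nth[OF xs] by (auto simp: list_power_carrier zs_def)
  have "\<mu> (zs D) = (\<Otimes>\<^bsub>F\<^esub>s\<in>D. c s) \<odot>\<^bsub>V\<^esub> \<mu> xs" if "finite D" "D \<subseteq> {..<r}" for D
    using that
  proof (induction D rule: finite_induct)
    case empty
    have "zs {} = xs" using xs by (auto simp: zs_def list_power_carrier intro!: nth_equalityI)
    then show ?case using xs by simp
  next
    case (insert s D)
    then have s: "s < r" "xs ! s \<in> carrier A" "c s \<in> carrier F" using c list_power_nth[OF xs] by auto
    have p: "(\<Otimes>\<^bsub>F\<^esub>s\<in>D. c s) \<in> carrier F" using insert.prems c by (intro dom.R.finprod_closed) auto
    have "zs (insert s D) = (zs D)[s := c s \<odot>\<^bsub>A\<^esub> xs ! s]"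
      using s(1) by (intro nth_equalityI) (auto simp: zs_def nth_list_update)
    then have "\<mu> (zs (insert s D)) = c s \<odot>\<^bsub>V\<^esub> \<mu> ((zs D)[s := xs ! s])"
      using s by (simp add: map_smult[OF zs])
    also have "(zs D)[s := xs ! s] = zs D"
      using insert.hyps s(1) by (intro nth_equalityI) (auto simp: zs_def nth_list_update)
    also have "c s \<odot>\<^bsub>V\<^esub> \<mu> (zs D) = (c s \<otimes>\<^bsub>F\<^esub> (\<Otimes>\<^bsub>F\<^esub>s\<in>D. c s)) \<odot>\<^bsub>V\<^esub> \<mu> xs"
      using insert s p xs by (simp add: cod.smult_assoc1)
    also have "c s \<otimes>\<^bsub>F\<^esub> (\<Otimes>\<^bsub>F\<^esub>s\<in>D. c s) = (\<Otimes>\<^bsub>F\<^esub>s\<in>insert s D. c s)"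
      using insert c by (intro dom.R.finprod_insert[symmetric]) auto
    finally show ?case .
  qed
  moreover have "zs {..<r} = map (\<lambda>s. c s \<odot>\<^bsub>A\<^esub> xs ! s) [0..<r]" by (simp add: zs_def)
  ultimately show ?thesis by (metis finite_lessThan order_refl)
qed

end

lemma tensor_power_relations_closed:
  assumes A: "assoc_algebra F A"
  shows "tensor_power_relations F A r \<subseteq> carrier (monoid_algebra F (list_power_monoid A r))"
proof -
  interpret A: assoc_algebra F A by fact
  have F: "cring F" by (rule A.R.is_cring)
  have M: "monoid (list_power_monoid A r)" by (intro monoid_list_power_monoid A.A.monoid_axioms)
  interpret T: assoc_algebra F "monoid_algebra F (list_power_monoid A r)"
    by (rule monoid_algebra_assoc_algebra[OF F M])
  show ?thesis
    unfolding tensor_power_relations_def Let_def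
    by (auto intro!: T.M.minus_closed T.smult_closed T.M.a_closed basis_elt_closed[OF F M] list_power_update)
qed

lemma power_tensor_multilinear:
  assumes A: "assoc_algebra F A"
  shows "multilinear_map F A (tensor_power F A r) r (power_tensor F A r)"
    and "\<lbrakk>xs \<in> carrier (list_power_monoid A r); ys \<in> carrier (list_power_monoid A r)\<rbrakk> \<Longrightarrow>
      power_tensor F A r xs \<otimes>\<^bsub>tensor_power F A r\<^esub> power_tensor F A r ys =
      power_tensor F A r (xs \<otimes>\<^bsub>list_power_monoid A r\<^esub> ys)"
proof -
  interpret A: assoc_algebra F A by fact
  have F: "cring F" by (rule A.R.is_cring)
  have M: "monoid (list_power_monoid A r)" by (intro monoid_list_power_monoid A.A.monoid_axioms)
  let ?L = "list_power_monoid A r"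
  let ?T = "monoid_algebra F ?L" and ?Q = "tensor_power F A r" and ?I = "tensor_power_ideal F A r"
  interpret T: assoc_algebra F ?T by (rule monoid_algebra_assoc_algebra[OF F M])
  interpret Q: assoc_algebra F ?Q by (rule tensor_power_assoc_algebra[OF A])
  have I: "ideal ?I ?T" and rel: "tensor_power_relations F A r \<subseteq> ?I"
    unfolding tensor_power_ideal_def
    by (rule T.A.genideal_ideal T.A.genideal_self, rule tensor_power_relations_closed[OF A])+
  note ops = power_tensor_def tensor_power_def T.quotient_ops[OF I] T.quotient_smult[OF I]
    basis_elt_closed[OF F M] list_power_update
  show "multilinear_map F A ?Q r (power_tensor F A r)"
  proof (intro multilinear_map.intro multilinear_map_axioms.intro A.module_axioms Q.module_axioms)
    fix xs assume "xs \<in> carrier ?L"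
    then show "power_tensor F A r xs \<in> carrier ?Q"
      by (simp add: ops T.quotient_carrier)
  next
    fix xs s x y assume c: "xs \<in> carrier ?L" "s < r" "x \<in> carrier A" "y \<in> carrier A"
    then have "basis_elt F (xs[s := x \<oplus>\<^bsub>A\<^esub> y]) \<ominus>\<^bsub>?T\<^esub>
        (basis_elt F (xs[s := x]) \<oplus>\<^bsub>?T\<^esub> basis_elt F (xs[s := y])) \<in> ?I"
      by (intro subsetD[OF rel]) (fastforce simp: tensor_power_relations_def Let_def)
    then show "power_tensor F A r (xs[s := x \<oplus>\<^bsub>A\<^esub> y]) =
        power_tensor F A r (xs[s := x]) \<oplus>\<^bsub>?Q\<^esub> power_tensor F A r (xs[s := y])"
      using c by (simp add: ops T.coset_eqI[OF I])
  next
    fix xs s c x assume c: "xs \<in> carrier ?L" "s < r" "c \<in> carrier F" "x \<in> carrier A"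
    then have "basis_elt F (xs[s := c \<odot>\<^bsub>A\<^esub> x]) \<ominus>\<^bsub>?T\<^esub> c \<odot>\<^bsub>?T\<^esub> basis_elt F (xs[s := x]) \<in> ?I"
      by (intro subsetD[OF rel]) (fastforce simp: tensor_power_relations_def Let_def)
    then show "power_tensor F A r (xs[s := c \<odot>\<^bsub>A\<^esub> x]) = c \<odot>\<^bsub>?Q\<^esub> power_tensor F A r (xs[s := x])"
      using c by (simp add: ops T.coset_eqI[OF I])
  qed
  assume "xs \<in> carrier ?L" "ys \<in> carrier ?L"
  then show "power_tensor F A r xs \<otimes>\<^bsub>?Q\<^esub> power_tensor F A r ys = power_tensor F A r (xs \<otimes>\<^bsub>?L\<^esub> ys)"
    by (simp add: ops ma_basis_mult[OF F M])
qed

lemma tensor_power_universal: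
  assumes A: "assoc_algebra F A" and \<mu>: "multilinear_map F A V r \<mu>"
  obtains h where "linear_map F (tensor_power F A r) V h"
    and "\<And>xs. xs \<in> carrier (list_power_monoid A r) \<Longrightarrow> h (power_tensor F A r xs) = \<mu> xs"
proof -
  interpret A: assoc_algebra F A by fact
  interpret \<mu>: multilinear_map F A V r \<mu> by fact
  have F: "cring F" by (rule A.R.is_cring)
  let ?L = "list_power_monoid A r" and ?T = "monoid_algebra F (list_power_monoid A r)"
  have M: "monoid ?L" by (intro monoid_list_power_monoid A.A.monoid_axioms)
  interpret M: monoid ?L by (rule M)
  interpret T: assoc_algebra F ?T by (rule monoid_algebra_assoc_algebra[OF F M])
  show ?thesis
  proof (rule linear_map_presented_algebra[where \<phi> = \<mu>,
        OF M \<mu>.cod.module_axioms tensor_power_relations_closed[OF A]])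
    fix \<Psi> g us vs
    assume \<Psi>: "linear_map F ?T V \<Psi>" and us: "us \<in> carrier ?L" and vs: "vs \<in> carrier ?L"
      and eq: "\<And>w. w \<in> carrier ?L \<Longrightarrow> \<Psi> (basis_elt F w) = \<mu> (us \<otimes>\<^bsub>?L\<^esub> w \<otimes>\<^bsub>?L\<^esub> vs)"
      and g: "g \<in> tensor_power_relations F A r"
    interpret \<Psi>: linear_map F ?T V \<Psi> by fact
    have eq': "\<Psi> (basis_elt F (xs[s := x])) =
        \<mu> ((us \<otimes>\<^bsub>?L\<^esub> xs \<otimes>\<^bsub>?L\<^esub> vs)[s := us ! s \<otimes>\<^bsub>A\<^esub> x \<otimes>\<^bsub>A\<^esub> vs ! s])"
      if "xs \<in> carrier ?L" "s < r" "x \<in> carrier A" for xs s x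
      using that us vs by (simp add: eq list_power_update list_power_mult_update)
    have b: "basis_elt F (xs[s := x]) \<in> carrier ?T" if "xs \<in> carrier ?L" "x \<in> carrier A" for xs s x
      using that by (intro basis_elt_closed[OF F M] list_power_update)
    have n: "us ! s \<in> carrier A" "vs ! s \<in> carrier A" if "s < r" for s
      using that us vs by (auto intro: list_power_nth)
    have z: "x \<in> carrier V \<Longrightarrow> x \<ominus>\<^bsub>V\<^esub> x = \<zero>\<^bsub>V\<^esub>" for x
      by (simp add: a_minus_def \<mu>.cod.M.r_neg)
    show "\<Psi> g = \<zero>\<^bsub>V\<^esub>"
      using g us vs unfolding tensor_power_relations_def Let_def
      by (auto simp: \<Psi>.map_minus \<Psi>.map_add \<Psi>.map_smult b eq' n z list_power_update A.A.r_distr A.A.l_distr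
          A.smult_mult_l A.smult_mult_r \<mu>.map_add \<mu>.map_smult)
  next
    fix h
    assume "linear_map F (quotient_algebra ?T (Idl\<^bsub>?T\<^esub> tensor_power_relations F A r)) V h"
      and "\<And>xs. xs \<in> carrier ?L \<Longrightarrow>
        h ((Idl\<^bsub>?T\<^esub> tensor_power_relations F A r) +>\<^bsub>?T\<^esub> basis_elt F xs) = \<mu> xs"
    then show thesis
      by (intro that[of h]) (auto simp: tensor_power_def power_tensor_def tensor_power_ideal_def)
  qed simp
qed

text \<open>
  Linear functionals are the linear maps into this module.
\<close>

definition regular_module :: "('f, 'c) ring_scheme \<Rightarrow> ('f, 'f) module"
  where "regular_module F = \<lparr>carrier = carrier F, monoid.mult = monoid.mult F, one = \<one>\<^bsub>F\<^esub>,
    ring.zero = \<zero>\<^bsub>F\<^esub>, add = add F, module.smult = monoid.mult F\<rparr>"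

lemma regular_module_simps [simp]:
  "carrier (regular_module F) = carrier F" "\<zero>\<^bsub>regular_module F\<^esub> = \<zero>\<^bsub>F\<^esub>"
  "x \<oplus>\<^bsub>regular_module F\<^esub> y = x \<oplus>\<^bsub>F\<^esub> y" "c \<odot>\<^bsub>regular_module F\<^esub> x = c \<otimes>\<^bsub>F\<^esub> x"
  by (simp_all add: regular_module_def)

lemma module_regular_module:
  assumes "cring F"
  shows "module F (regular_module F)"
proof -
  interpret F: cring F by fact
  have "abelian_group (regular_module F)"
    by (rule abelian_groupI) (auto simp: F.a_ac intro: F.l_neg)
  then show ?thesis
    using assms by (intro moduleI) (auto simp: F.l_distr F.r_distr F.m_assoc)
qed

text \<open>
  Changing the argument in slot \<open>s\<close> changes only the factor with index \<open>s\<close>.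
\<close>

lemma multilinear_map_prod:
  assumes A: "module F A" and l: "\<And>s. s < r \<Longrightarrow> linear_map F A (regular_module F) (l s)"
  shows "multilinear_map F A (regular_module F) r (\<lambda>xs. \<Otimes>\<^bsub>F\<^esub>s\<in>{..<r}. l s (xs ! s))"
proof -
  interpret A: module F A by fact
  have l_closed: "l s x \<in> carrier F" if "s < r" "x \<in> carrier A" for s x
    using linear_map.map_closed[OF l] that by fastforce
  have split: "(\<Otimes>\<^bsub>F\<^esub>t\<in>{..<r}. l t (xs[s := x] ! t)) = l s x \<otimes>\<^bsub>F\<^esub> (\<Otimes>\<^bsub>F\<^esub>t\<in>{..<r} - {s}. l t (xs ! t))"
    and rest: "(\<Otimes>\<^bsub>F\<^esub>t\<in>{..<r} - {s}. l t (xs ! t)) \<in> carrier F"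
    if xs: "xs \<in> carrier (list_power_monoid A r)" "s < r" "x \<in> carrier A" for xs s x
  proof -
    have c: "l t (xs ! t) \<in> carrier F" if "t < r" for t
      using that xs by (intro l_closed list_power_nth)
    have i: "{..<r} = insert s ({..<r} - {s})" using xs by auto
    have "(\<Otimes>\<^bsub>F\<^esub>t\<in>{..<r}. l t (xs[s := x] ! t)) =
        (\<Otimes>\<^bsub>F\<^esub>t\<in>insert s ({..<r} - {s}). l t (xs[s := x] ! t))"
      using i by simp
    also have "\<dots> = l s x \<otimes>\<^bsub>F\<^esub> (\<Otimes>\<^bsub>F\<^esub>t\<in>{..<r} - {s}. l t (xs[s := x] ! t))"
      using xs c l_closed by (subst A.R.finprod_insert) (auto simp: list_power_carrier nth_list_update)
    also have "(\<Otimes>\<^bsub>F\<^esub>t\<in>{..<r} - {s}. l t (xs[s := x] ! t)) = (\<Otimes>\<^bsub>F\<^esub>t\<in>{..<r} - {s}. l t (xs ! t))"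
      using c by (intro A.R.finprod_cong') auto
    finally show "(\<Otimes>\<^bsub>F\<^esub>t\<in>{..<r}. l t (xs[s := x] ! t)) = l s x \<otimes>\<^bsub>F\<^esub> (\<Otimes>\<^bsub>F\<^esub>t\<in>{..<r} - {s}. l t (xs ! t))" .
    show "(\<Otimes>\<^bsub>F\<^esub>t\<in>{..<r} - {s}. l t (xs ! t)) \<in> carrier F"
      using c by (intro A.R.finprod_closed) auto
  qed
  show ?thesis
  proof (intro multilinear_map.intro multilinear_map_axioms.intro A module_regular_module A.R.is_cring)
    fix xs assume xs: "xs \<in> carrier (list_power_monoid A r)"
    then show "(\<Otimes>\<^bsub>F\<^esub>s\<in>{..<r}. l s (xs ! s)) \<in> carrier (regular_module F)"
      by (auto intro!: A.R.finprod_closed l_closed list_power_nth)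
  next
    fix xs s x y assume *: "xs \<in> carrier (list_power_monoid A r)" "s < r" "x \<in> carrier A" "y \<in> carrier A"
    then show "(\<Otimes>\<^bsub>F\<^esub>t\<in>{..<r}. l t (xs[s := x \<oplus>\<^bsub>A\<^esub> y] ! t)) =
      (\<Otimes>\<^bsub>F\<^esub>t\<in>{..<r}. l t (xs[s := x] ! t)) \<oplus>\<^bsub>regular_module F\<^esub> (\<Otimes>\<^bsub>F\<^esub>t\<in>{..<r}. l t (xs[s := y] ! t))"
      by (simp add: split rest linear_map.map_add[OF l] l_closed A.R.l_distr)
  next
    fix xs s c x assume *: "xs \<in> carrier (list_power_monoid A r)" "s < r" "c \<in> carrier F" "x \<in> carrier A"
    then show "(\<Otimes>\<^bsub>F\<^esub>t\<in>{..<r}. l t (xs[s := c \<odot>\<^bsub>A\<^esub> x] ! t)) =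
      c \<odot>\<^bsub>regular_module F\<^esub> (\<Otimes>\<^bsub>F\<^esub>t\<in>{..<r}. l t (xs[s := x] ! t))"
      by (simp add: split rest linear_map.map_smult[OF l] l_closed A.R.m_assoc)
  qed
qed

section \<open>Degree two of the quantum exterior algebra\<close>

context
  fixes F :: "('f, 'c) ring_scheme" and q :: 'f and n :: nat
  assumes F: "cring F" and q: "q \<in> carrier F"
begin

interpretation F: cring F by (fact F)

interpretation free: assoc_algebra F "free_algebra F n"
  unfolding free_algebra_def by (rule monoid_algebra_assoc_algebra[OF F monoid_free_monoid])

interpretation \<Lambda>: assoc_algebra F "quantum_exterior F q n"
  by (rule quantum_exterior_assoc_algebra[OF F q])

abbreviation (input) qext where "qext \<equiv> quantum_exterior F q n"
abbreviation (input) gen where "gen \<equiv> qext_gen F q n"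

lemma word_closed: "set w \<subseteq> {1..n} \<Longrightarrow> basis_elt F w \<in> carrier (free_algebra F n)"
  unfolding free_algebra_def
  by (rule basis_elt_closed[OF F monoid_free_monoid]) (simp add: free_monoid_def in_lists_conv_set subset_eq)

lemma word_mult:
  "\<lbrakk>set v \<subseteq> {1..n}; set w \<subseteq> {1..n}\<rbrakk>
    \<Longrightarrow> basis_elt F v \<otimes>\<^bsub>free_algebra F n\<^esub> basis_elt F w = basis_elt F (v @ w)"
  unfolding free_algebra_def
  by (subst ma_basis_mult[OF F monoid_free_monoid]) (auto simp add: free_monoid_def)

lemma qext_relations_closed: "qext_relations F q n \<subseteq> carrier (free_algebra F n)"
  unfolding qext_relations_def Let_def
  by (auto intro!: free.M.minus_closed free.smult_closed free.A.m_closed word_closed q)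

lemma qext_ideal:
  shows "ideal (qext_ideal F q n) (free_algebra F n)" and "qext_relations F q n \<subseteq> qext_ideal F q n"
  unfolding qext_ideal_def
  by (rule free.A.genideal_ideal free.A.genideal_self, rule qext_relations_closed)+

lemma qext_gen_closed: "i \<in> {1..n} \<Longrightarrow> gen i \<in> carrier qext"
  by (simp add: qext_gen_def quantum_exterior_def free.quotient_carrier word_closed)

lemma qext_gen_swap:
  assumes "1 \<le> i" "i < j" "j \<le> n"
  shows "gen j \<otimes>\<^bsub>qext\<^esub> gen i = (\<ominus>\<^bsub>F\<^esub> q) \<odot>\<^bsub>qext\<^esub> (gen i \<otimes>\<^bsub>qext\<^esub> gen j)"
proof -
  let ?T = "free_algebra F n" and ?e = "\<lambda>i. basis_elt F [i]"
  have c: "?e i \<in> carrier ?T" "?e j \<in> carrier ?T" using assms by (auto intro: word_closed)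
  have "?e j \<otimes>\<^bsub>?T\<^esub> ?e i \<ominus>\<^bsub>?T\<^esub> (\<ominus>\<^bsub>F\<^esub> q) \<odot>\<^bsub>?T\<^esub> (?e i \<otimes>\<^bsub>?T\<^esub> ?e j) \<in> qext_ideal F q n"
    using assms by (intro subsetD[OF qext_ideal(2)]) (auto simp: qext_relations_def Let_def)
  then show ?thesis
    using c q
    by (simp add: qext_gen_def quantum_exterior_def free.quotient_ops[OF qext_ideal(1)]
        free.quotient_smult[OF qext_ideal(1)] free.coset_eqI[OF qext_ideal(1)])
qed

lemma qext_gen_square:
  assumes "1 \<le> i" "i \<le> n"
  shows "gen i \<otimes>\<^bsub>qext\<^esub> gen i = \<zero>\<^bsub>qext\<^esub>"
proof -
  let ?T = "free_algebra F n" and ?e = "\<lambda>i. basis_elt F [i]"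
  have c: "?e i \<in> carrier ?T" using assms by (auto intro: word_closed)
  have "?e i \<otimes>\<^bsub>?T\<^esub> ?e i \<in> qext_ideal F q n"
    using assms by (intro subsetD[OF qext_ideal(2)]) (auto simp: qext_relations_def Let_def)
  then have "?e i \<otimes>\<^bsub>?T\<^esub> ?e i \<ominus>\<^bsub>?T\<^esub> \<zero>\<^bsub>?T\<^esub> \<in> qext_ideal F q n"
    using c by (simp add: a_minus_def)
  then show ?thesis
    using c
    by (simp add: qext_gen_def quantum_exterior_def free.quotient_ops[OF qext_ideal(1)]
        free.quotient_zero[OF qext_ideal(1)] free.coset_eqI[OF qext_ideal(1)])
qed

text \<open>
  The functional that reads off the coefficient of \<open>x\<^sub>a \<and> x\<^sub>b\<close>. On words it sends \<open>[a, b]\<close> to \<open>1\<close>,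
  \<open>[b, a]\<close> to \<open>-q\<close>, in accordance with \<open>x\<^sub>b \<and> x\<^sub>a = -q x\<^sub>a \<and> x\<^sub>b\<close>, and every other word to \<open>0\<close>. The
  relations are homogeneous of degree two, so a relation multiplied by a nonempty word involves only
  words of length at least three, where the functional is zero.
\<close>

lemma qext_coordinate:
  assumes "a \<in> {1..n}" "b \<in> {1..n}" "a < b"
  obtains l where "linear_map F qext (regular_module F) l"
    and "\<And>c d. \<lbrakk>c \<in> {1..n}; d \<in> {1..n}; c < d\<rbrakk> \<Longrightarrow>
      l (gen c \<otimes>\<^bsub>qext\<^esub> gen d) = (if c = a \<and> d = b then \<one>\<^bsub>F\<^esub> else \<zero>\<^bsub>F\<^esub>)"
proof (rule linear_map_presented_algebra[where F = F and V = "regular_module F"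
      and M = "free_monoid {1..n}" and G = "qext_relations F q n"
      and \<phi> = "\<lambda>w. if w = [a, b] then \<one>\<^bsub>F\<^esub> else if w = [b, a] then \<ominus>\<^bsub>F\<^esub> q else \<zero>\<^bsub>F\<^esub>",
      folded free_algebra_def])
  show "monoid (free_monoid {1..n})" by (rule monoid_free_monoid)
  show "module F (regular_module F)" by (rule module_regular_module[OF F])
  show "qext_relations F q n \<subseteq> carrier (free_algebra F n)" by (rule qext_relations_closed)
next
  fix \<Psi> g u v
  assume \<Psi>: "linear_map F (free_algebra F n) (regular_module F) \<Psi>"
    and eq: "\<And>w. w \<in> carrier (free_monoid {1..n}) \<Longrightarrow> \<Psi> (basis_elt F w) =
      (if u \<otimes>\<^bsub>free_monoid {1..n}\<^esub> w \<otimes>\<^bsub>free_monoid {1..n}\<^esub> v = [a, b] then \<one>\<^bsub>F\<^esub>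
       else if u \<otimes>\<^bsub>free_monoid {1..n}\<^esub> w \<otimes>\<^bsub>free_monoid {1..n}\<^esub> v = [b, a] then \<ominus>\<^bsub>F\<^esub> q else \<zero>\<^bsub>F\<^esub>)"
    and g: "g \<in> qext_relations F q n"
  interpret \<Psi>: linear_map F "free_algebra F n" "regular_module F" \<Psi> by fact
  \<comment> \<open>A word \<open>u @ [i, j] @ v\<close> has length two only if \<open>u\<close> and \<open>v\<close> are empty.\<close>
  have eq': "\<Psi> (basis_elt F [i, j]) =
      (if u = [] \<and> v = [] \<and> i = a \<and> j = b then \<one>\<^bsub>F\<^esub>
       else if u = [] \<and> v = [] \<and> i = b \<and> j = a then \<ominus>\<^bsub>F\<^esub> q else \<zero>\<^bsub>F\<^esub>)"
    if "i \<in> {1..n}" "j \<in> {1..n}" for i j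
    using that assms(3) by (subst eq) (auto simp: free_monoid_def append_eq_Cons_conv Cons_eq_append_conv)
  have sub: "\<Psi> (y \<ominus>\<^bsub>free_algebra F n\<^esub> c \<odot>\<^bsub>free_algebra F n\<^esub> z) = \<Psi> y \<oplus>\<^bsub>F\<^esub> (\<ominus>\<^bsub>F\<^esub> c) \<otimes>\<^bsub>F\<^esub> \<Psi> z"
    if "y \<in> carrier (free_algebra F n)" "z \<in> carrier (free_algebra F n)" "c \<in> carrier F" for y z c
    using that by (simp add: a_minus_def \<Psi>.map_add \<Psi>.map_smult free.smult_l_minus[symmetric])
  consider i j where "1 \<le> i" "i < j" "j \<le> n"
      "g = basis_elt F [j, i] \<ominus>\<^bsub>free_algebra F n\<^esub> (\<ominus>\<^bsub>F\<^esub> q) \<odot>\<^bsub>free_algebra F n\<^esub> basis_elt F [i, j]"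
    | i where "1 \<le> i" "i \<le> n" "g = basis_elt F [i, i]"
    using g by (auto simp: qext_relations_def Let_def word_mult)
  then have "\<Psi> g = \<zero>\<^bsub>F\<^esub>"
  proof cases
    case 1
    then show ?thesis using q assms(3)
      by (auto simp: sub word_closed eq' F.l_neg)
  next
    case 2
    then show ?thesis using assms(3) by (auto simp: eq')
  qed
  then show "\<Psi> g = \<zero>\<^bsub>regular_module F\<^esub>" by simp
next
  fix h
  assume h: "linear_map F (quotient_algebra (free_algebra F n)
      (Idl\<^bsub>free_algebra F n\<^esub> qext_relations F q n)) (regular_module F) h"
    and eq: "\<And>u. u \<in> carrier (free_monoid {1..n}) \<Longrightarrow>
      h ((Idl\<^bsub>free_algebra F n\<^esub> qext_relations F q n) +>\<^bsub>free_algebra F n\<^esub> basis_elt F u) =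
      (if u = [a, b] then \<one>\<^bsub>F\<^esub> else if u = [b, a] then \<ominus>\<^bsub>F\<^esub> q else \<zero>\<^bsub>F\<^esub>)"
  show thesis
  proof (rule that)
    show "linear_map F qext (regular_module F) h"
      using h by (simp add: quantum_exterior_def qext_ideal_def)
    fix c d assume *: "c \<in> {1..n}" "d \<in> {1..n}" "c < d"
    then have "gen c \<otimes>\<^bsub>qext\<^esub> gen d = qext_ideal F q n +>\<^bsub>free_algebra F n\<^esub> basis_elt F [c, d]"
      by (simp add: qext_gen_def quantum_exterior_def free.quotient_ops[OF qext_ideal(1)] word_closed word_mult)
    then show "h (gen c \<otimes>\<^bsub>qext\<^esub> gen d) = (if c = a \<and> d = b then \<one>\<^bsub>F\<^esub> else \<zero>\<^bsub>F\<^esub>)"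
      using * assms(3) by (auto simp: eq[folded qext_ideal_def] free_monoid_def)
  qed
qed (use q in auto)

definition wedge_pair :: "nat set \<Rightarrow> (nat list \<Rightarrow> 'f) set"
  where "wedge_pair I = gen (Min I) \<otimes>\<^bsub>qext\<^esub> gen (Max I)"

text \<open>
  The tensor whose factors are the ordered products \<open>x\<^bsub>min I\<^esub> \<and> x\<^bsub>max I\<^esub>\<close>, with \<open>I\<close> running through the
  factors of the box \<open>J\<close>.
\<close>

definition box_tensor :: "nat set list \<Rightarrow> ((nat list \<Rightarrow> 'f) set list \<Rightarrow> 'f) set"
  where "box_tensor J = power_tensor F qext (length J) (map wedge_pair J)"

lemma pair_set_Min_Max:
  assumes "I \<subseteq> {1..n}" "card I = 2"
  shows "Min I \<in> {1..n}" "Max I \<in> {1..n}" "Min I < Max I" "I = {Min I, Max I}"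
proof -
  obtain a b where "I = {a, b}" "a \<noteq> b" using assms(2) by (auto simp: card_2_iff)
  then show "Min I \<in> {1..n}" "Max I \<in> {1..n}" "Min I < Max I" "I = {Min I, Max I}"
    using assms(1) by (auto simp: min_def max_def)
qed

lemma wedge_pair_closed: "\<lbrakk>I \<subseteq> {1..n}; card I = 2\<rbrakk> \<Longrightarrow> wedge_pair I \<in> carrier qext"
  unfolding wedge_pair_def by (intro \<Lambda>.A.m_closed qext_gen_closed pair_set_Min_Max)

lemma qext_gen_mult_pair:
  assumes "a \<in> {1..n}" "b \<in> {1..n}" "a \<noteq> b"
  shows "gen a \<otimes>\<^bsub>qext\<^esub> gen b = (if a > b then \<ominus>\<^bsub>F\<^esub> q else \<one>\<^bsub>F\<^esub>) \<odot>\<^bsub>qext\<^esub> wedge_pair {a, b}"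
proof (cases "a > b")
  case True
  then show ?thesis using assms qext_gen_swap[of b a] by (simp add: wedge_pair_def min_def max_def)
next
  case False
  then have "gen a \<otimes>\<^bsub>qext\<^esub> gen b \<in> carrier qext" "min a b = a" "max a b = b"
    using assms(1,2) by (simp_all add: \<Lambda>.A.m_closed qext_gen_closed del: atLeastAtMost_iff)
  then show ?thesis using False by (simp add: wedge_pair_def)
qed

lemma box_list_closed:
  "J \<in> pair_boxes n r \<Longrightarrow> map wedge_pair J \<in> carrier (list_power_monoid qext r)"
  by (auto simp: list_power_carrier pair_boxes_def wedge_pair_closed)

lemma gen_list_closed:
  "\<alpha> \<in> multi_indices n r \<Longrightarrow> map gen \<alpha> \<in> carrier (list_power_monoid qext r)"
  by (auto simp: list_power_carrier multi_indices_def qext_gen_closed)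

lemma finprod_inv_count:
  assumes "length \<alpha> = r"
  shows "(\<Otimes>\<^bsub>F\<^esub>s\<in>{..<r}. if \<alpha> ! s > \<beta> ! s then \<ominus>\<^bsub>F\<^esub> q else \<one>\<^bsub>F\<^esub>) = (\<ominus>\<^bsub>F\<^esub> q) [^]\<^bsub>F\<^esub> inv_count \<alpha> \<beta>"
proof -
  have "(\<Otimes>\<^bsub>F\<^esub>s\<in>{..<r}. if \<alpha> ! s > \<beta> ! s then \<ominus>\<^bsub>F\<^esub> q else \<one>\<^bsub>F\<^esub>) =
      (\<Otimes>\<^bsub>F\<^esub>s\<in>{s. s < length \<alpha> \<and> \<alpha> ! s > \<beta> ! s}. \<ominus>\<^bsub>F\<^esub> q)"
    using assms q by (intro F.finprod_mono_neutral_cong_right) auto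
  then show ?thesis using q by (simp add: F.finprod_const inv_count_def)
qed

text \<open>
  Sorting \<open>x\<^bsub>\<alpha>\<^sub>s\<^esub> \<and> x\<^bsub>\<beta>\<^sub>s\<^esub>\<close> costs a factor \<open>-q\<close> exactly when \<open>\<alpha>\<^sub>s > \<beta>\<^sub>s\<close>, and multilinearity collects these
  factors into \<open>(-q)\<^bsup>inv(\<alpha>,\<beta>)\<^esup>\<close>.
\<close>

lemma gen_tensor_mult_splitting:
  assumes J: "J \<in> pair_boxes n r" and ab: "(\<alpha>, \<beta>) \<in> splittings J"
  shows "power_tensor F qext r (map gen \<alpha>) \<otimes>\<^bsub>tensor_power F qext r\<^esub> power_tensor F qext r (map gen \<beta>) =
    ((\<ominus>\<^bsub>F\<^esub> q) [^]\<^bsub>F\<^esub> inv_count \<alpha> \<beta>) \<odot>\<^bsub>tensor_power F qext r\<^esub> box_tensor J"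
proof -
  interpret P: multilinear_map F qext "tensor_power F qext r" r "power_tensor F qext r"
    by (rule power_tensor_multilinear(1)[OF \<Lambda>.assoc_algebra_axioms])
  have len: "length J = r" "length \<alpha> = r" "length \<beta> = r"
    using J ab by (auto simp: pair_boxes_def splittings_def)
  have s: "{\<alpha> ! s, \<beta> ! s} = J ! s" "\<alpha> ! s \<noteq> \<beta> ! s" "\<alpha> ! s \<in> {1..n}" "\<beta> ! s \<in> {1..n}" if "s < r" for s
  proof -
    show e: "{\<alpha> ! s, \<beta> ! s} = J ! s" using ab that len by (auto simp: splittings_def)
    have "J ! s \<in> set J" using that len by simp
    then have "J ! s \<subseteq> {1..n}" "card (J ! s) = 2" using J unfolding pair_boxes_def by blast+
    then show "\<alpha> ! s \<noteq> \<beta> ! s" "\<alpha> ! s \<in> {1..n}" "\<beta> ! s \<in> {1..n}"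
      by (auto simp flip: e)
  qed
  have mi: "\<alpha> \<in> multi_indices n r" "\<beta> \<in> multi_indices n r"
    using s(3,4) len by (auto simp: multi_indices_def in_set_conv_nth simp del: atLeastAtMost_iff)
  let ?c = "\<lambda>s. if \<alpha> ! s > \<beta> ! s then \<ominus>\<^bsub>F\<^esub> q else \<one>\<^bsub>F\<^esub>"
  have "map gen \<alpha> \<otimes>\<^bsub>list_power_monoid qext r\<^esub> map gen \<beta> =
      map (\<lambda>s. ?c s \<odot>\<^bsub>qext\<^esub> map wedge_pair J ! s) [0..<r]"
  proof (rule nth_equalityI)
    fix t assume "t < length (map gen \<alpha> \<otimes>\<^bsub>list_power_monoid qext r\<^esub> map gen \<beta>)"
    then have t: "t < r" by (simp add: list_power_mult len)
    show "(map gen \<alpha> \<otimes>\<^bsub>list_power_monoid qext r\<^esub> map gen \<beta>) ! t =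
        map (\<lambda>s. ?c s \<odot>\<^bsub>qext\<^esub> map wedge_pair J ! s) [0..<r] ! t"
      using qext_gen_mult_pair[OF s(3,4,2)[OF t]] t by (simp add: list_power_mult len s(1))
  qed (simp add: list_power_mult len)
  then have "power_tensor F qext r (map gen \<alpha>) \<otimes>\<^bsub>tensor_power F qext r\<^esub> power_tensor F qext r (map gen \<beta>) =
      (\<Otimes>\<^bsub>F\<^esub>s\<in>{..<r}. ?c s) \<odot>\<^bsub>tensor_power F qext r\<^esub> power_tensor F qext r (map wedge_pair J)"
    using q
    by (simp add: power_tensor_multilinear(2)[OF \<Lambda>.assoc_algebra_axioms] gen_list_closed mi
        P.map_smult_all[OF box_list_closed[OF J]])
  then show ?thesis by (simp add: finprod_inv_count len box_tensor_def)
qed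

lemma gen_tensor_mult_coincident:
  assumes \<alpha>: "\<alpha> \<in> multi_indices n r" and \<beta>: "\<beta> \<in> multi_indices n r" and s: "s < r" "\<alpha> ! s = \<beta> ! s"
  shows "power_tensor F qext r (map gen \<alpha>) \<otimes>\<^bsub>tensor_power F qext r\<^esub> power_tensor F qext r (map gen \<beta>) =
    \<zero>\<^bsub>tensor_power F qext r\<^esub>"
proof -
  interpret P: multilinear_map F qext "tensor_power F qext r" r "power_tensor F qext r"
    by (rule power_tensor_multilinear(1)[OF \<Lambda>.assoc_algebra_axioms])
  let ?zs = "map gen \<alpha> \<otimes>\<^bsub>list_power_monoid qext r\<^esub> map gen \<beta>"
  interpret L: monoid "list_power_monoid qext r"
    by (rule monoid_list_power_monoid[OF \<Lambda>.A.monoid_axioms])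
  have zs: "?zs \<in> carrier (list_power_monoid qext r)" using \<alpha> \<beta> by (intro L.m_closed gen_list_closed)
  have len: "length \<alpha> = r" "length \<beta> = r" using \<alpha> \<beta> by (auto simp: multi_indices_def)
  have "\<beta> ! s \<in> set \<beta>" using s len by simp
  then have "\<beta> ! s \<in> {1..n}" using \<beta> unfolding multi_indices_def by blast
  then have "?zs ! s = \<zero>\<^bsub>qext\<^esub>"
    using s len by (simp add: list_power_mult qext_gen_square)
  \<comment> \<open>Writing the zero entry as a multiple by the scalar \<open>0\<close> lets multilinearity pull the \<open>0\<close> out.\<close>
  then have "?zs = ?zs[s := \<zero>\<^bsub>F\<^esub> \<odot>\<^bsub>qext\<^esub> \<zero>\<^bsub>qext\<^esub>]"
    using list_update_id[of ?zs s] by simp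
  then have "power_tensor F qext r ?zs = \<zero>\<^bsub>F\<^esub> \<odot>\<^bsub>tensor_power F qext r\<^esub> power_tensor F qext r (?zs[s := \<zero>\<^bsub>qext\<^esub>])"
    using P.map_smult[OF zs s(1) F.zero_closed \<Lambda>.M.zero_closed] by simp
  also have "\<dots> = \<zero>\<^bsub>tensor_power F qext r\<^esub>"
    using list_power_update[OF zs \<Lambda>.M.zero_closed] by simp
  finally show ?thesis
    by (simp add: power_tensor_multilinear(2)[OF \<Lambda>.assoc_algebra_axioms] gen_list_closed \<alpha> \<beta>)
qed

text \<open>
  The product over the slots of the degree-two coordinates at \<open>J ! s\<close> is a multilinear form, hence a
  functional on the tensor power; on the tensor of a box \<open>K\<close> it has a factor \<open>0\<close> as soon as \<open>K\<close>
  differs from \<open>J\<close> in some slot.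
\<close>

lemma box_tensor_coordinate:
  assumes J: "J \<in> pair_boxes n r"
  obtains \<psi> where "linear_map F (tensor_power F qext r) (regular_module F) \<psi>"
    and "\<And>K. K \<in> pair_boxes n r \<Longrightarrow> \<psi> (box_tensor K) = (if K = J then \<one>\<^bsub>F\<^esub> else \<zero>\<^bsub>F\<^esub>)"
proof -
  have pair: "I \<subseteq> {1..n}" "card I = 2" if "K \<in> pair_boxes n r" "s < r" "I = K ! s" for K s I
    using that nth_mem[of s K] unfolding pair_boxes_def by auto
  have "\<exists>l. linear_map F qext (regular_module F) l \<and>
      (\<forall>I. I \<subseteq> {1..n} \<longrightarrow> card I = 2 \<longrightarrow> l (wedge_pair I) = (if I = J ! s then \<one>\<^bsub>F\<^esub> else \<zero>\<^bsub>F\<^esub>))"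
    if s: "s < r" for s
  proof -
    note Js = pair_set_Min_Max[OF pair[OF J s refl]]
    obtain l where l: "linear_map F qext (regular_module F) l"
      "\<And>c d. \<lbrakk>c \<in> {1..n}; d \<in> {1..n}; c < d\<rbrakk> \<Longrightarrow>
        l (gen c \<otimes>\<^bsub>qext\<^esub> gen d) = (if c = Min (J ! s) \<and> d = Max (J ! s) then \<one>\<^bsub>F\<^esub> else \<zero>\<^bsub>F\<^esub>)"
      using qext_coordinate[OF Js(1-3)] by blast
    have "l (wedge_pair I) = (if I = J ! s then \<one>\<^bsub>F\<^esub> else \<zero>\<^bsub>F\<^esub>)" if I: "I \<subseteq> {1..n}" "card I = 2" for I
    proof -
      note Is = pair_set_Min_Max[OF I]
      have "I = J ! s \<longleftrightarrow> Min I = Min (J ! s) \<and> Max I = Max (J ! s)"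
        using Is(4) Js(4) by metis
      then show ?thesis unfolding wedge_pair_def l(2)[OF Is(1-3)] by simp
    qed
    then show ?thesis using l(1) by blast
  qed
  then obtain l where l: "\<And>s. s < r \<Longrightarrow> linear_map F qext (regular_module F) (l s)"
    "\<And>s I. \<lbrakk>s < r; I \<subseteq> {1..n}; card I = 2\<rbrakk> \<Longrightarrow>
      l s (wedge_pair I) = (if I = J ! s then \<one>\<^bsub>F\<^esub> else \<zero>\<^bsub>F\<^esub>)"
    by metis
  obtain \<psi> where \<psi>: "linear_map F (tensor_power F qext r) (regular_module F) \<psi>"
    "\<And>xs. xs \<in> carrier (list_power_monoid qext r) \<Longrightarrow>
      \<psi> (power_tensor F qext r xs) = (\<Otimes>\<^bsub>F\<^esub>s\<in>{..<r}. l s (xs ! s))"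
    by (rule tensor_power_universal[OF \<Lambda>.assoc_algebra_axioms
          multilinear_map_prod[where l = l, OF \<Lambda>.module_axioms l(1)]]) (assumption, rule that)
  show thesis
  proof (rule that[OF \<psi>(1)])
    fix K assume K: "K \<in> pair_boxes n r"
    have len: "length K = r" "length J = r" using K J by (auto simp: pair_boxes_def)
    let ?d = "\<lambda>s. if K ! s = J ! s then \<one>\<^bsub>F\<^esub> else \<zero>\<^bsub>F\<^esub>"
    have lK: "l s (map wedge_pair K ! s) = ?d s" if "s < r" for s
      using l(2)[OF that pair[OF K that refl]] that len by simp
    have "\<psi> (box_tensor K) = (\<Otimes>\<^bsub>F\<^esub>s\<in>{..<r}. l s (map wedge_pair K ! s))"
      using \<psi>(2)[OF box_list_closed[OF K]] by (simp add: box_tensor_def len)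
    also have "\<dots> = (\<Otimes>\<^bsub>F\<^esub>s\<in>{..<r}. ?d s)"
      using lK by (intro F.finprod_cong') auto
    also have "\<dots> = (if K = J then \<one>\<^bsub>F\<^esub> else \<zero>\<^bsub>F\<^esub>)"
    proof (cases "K = J")
      case True
      then show ?thesis by simp
    next
      case False
      then obtain s where s: "s < r" "K ! s \<noteq> J ! s" using len by (metis nth_equalityI)
      then have "{..<r} = insert s ({..<r} - {s})" by auto
      then have "(\<Otimes>\<^bsub>F\<^esub>s\<in>{..<r}. ?d s) = (\<Otimes>\<^bsub>F\<^esub>s\<in>insert s ({..<r} - {s}). ?d s)" by simp
      also have "\<dots> = \<zero>\<^bsub>F\<^esub> \<otimes>\<^bsub>F\<^esub> (\<Otimes>\<^bsub>F\<^esub>s\<in>{..<r} - {s}. ?d s)"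
        using s by (subst F.finprod_insert) auto
      also have "\<dots> = \<zero>\<^bsub>F\<^esub>" by (intro F.l_null F.finprod_closed) auto
      finally show ?thesis using False by simp
    qed
    finally show "\<psi> (box_tensor K) = (if K = J then \<one>\<^bsub>F\<^esub> else \<zero>\<^bsub>F\<^esub>)" .
  qed
qed

end

section \<open>Splittings of boxes\<close>

lemma finite_multi_indices: "finite (multi_indices n r)"
proof -
  have "multi_indices n r = {xs. set xs \<subseteq> {1..n} \<and> length xs = r}"
    by (auto simp: multi_indices_def)
  then show ?thesis by (simp add: finite_lists_length_eq)
qed

lemma finite_pair_boxes: "finite (pair_boxes n r)"
proof (rule finite_subset)
  show "pair_boxes n r \<subseteq> {J. set J \<subseteq> Pow {1..n} \<and> length J = r}"
    by (auto simp: pair_boxes_def)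
  show "finite {J. set J \<subseteq> Pow {1..n} \<and> length J = r}"
    by (rule finite_lists_length_eq) simp
qed

lemma splittings_subset:
  assumes "J \<in> pair_boxes n r"
  shows "splittings J \<subseteq> multi_indices n r \<times> multi_indices n r"
proof
  fix p assume "p \<in> splittings J"
  then obtain \<alpha> \<beta> where p: "p = (\<alpha>, \<beta>)" and ab: "(\<alpha>, \<beta>) \<in> splittings J" by (cases p) auto
  have len: "length J = r" using assms by (simp add: pair_boxes_def)
  have "\<alpha> ! s \<in> {1..n} \<and> \<beta> ! s \<in> {1..n}" if "s < r" for s
  proof -
    have "J ! s \<subseteq> {1..n}" using assms that nth_mem[of s J] len unfolding pair_boxes_def by blast
    then show ?thesis using ab that len unfolding splittings_def by blast
  qed
  then show "p \<in> multi_indices n r \<times> multi_indices n r"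
    using ab len
    by (auto simp: p splittings_def multi_indices_def in_set_conv_nth simp del: atLeastAtMost_iff)
qed

lemma splittings_disjoint: "J \<noteq> K \<Longrightarrow> splittings J \<inter> splittings K = {}"
  by (force simp: splittings_def intro: nth_equalityI)

lemma splittings_cover:
  assumes \<alpha>: "\<alpha> \<in> multi_indices n r" and \<beta>: "\<beta> \<in> multi_indices n r"
    and ne: "\<And>s. s < r \<Longrightarrow> \<alpha> ! s \<noteq> \<beta> ! s"
  shows "\<exists>J\<in>pair_boxes n r. (\<alpha>, \<beta>) \<in> splittings J"
proof
  let ?J = "map2 (\<lambda>a b. {a, b}) \<alpha> \<beta>"
  have len: "length \<alpha> = r" "length \<beta> = r" using \<alpha> \<beta> by (auto simp: multi_indices_def)
  have "\<alpha> ! s \<in> {1..n}" "\<beta> ! s \<in> {1..n}" if "s < r" for s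
  proof -
    have "\<alpha> ! s \<in> set \<alpha>" "\<beta> ! s \<in> set \<beta>" using that len by simp_all
    then show "\<alpha> ! s \<in> {1..n}" "\<beta> ! s \<in> {1..n}"
      using \<alpha> \<beta> unfolding multi_indices_def by blast+
  qed
  then show "?J \<in> pair_boxes n r"
    using ne len by (auto simp: pair_boxes_def in_set_conv_nth simp del: atLeastAtMost_iff)
  show "(\<alpha>, \<beta>) \<in> splittings ?J" using len by (simp add: splittings_def)
qed

lemma slice_closed:
  assumes "\<And>\<iota>. \<iota> \<in> multi_indices n m \<Longrightarrow> a \<iota> \<in> C" "k \<in> {1..m}" "i \<in> {1..n}"
    "\<alpha> \<in> multi_indices n (m - 1)"
  shows "slice a k i \<alpha> \<in> C"
  unfolding slice_def
proof (rule assms(1))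
  show "take (k - 1) \<alpha> @ i # drop (k - 1) \<alpha> \<in> multi_indices n m"
    using assms(2-4) set_take_subset[of "k - 1" \<alpha>] set_drop_subset[of "k - 1" \<alpha>]
    by (auto simp: multi_indices_def)
qed

section \<open>Products of the forms attached to a hypermatrix\<close>

context
  fixes F :: "('f, 'c) ring_scheme" and R :: "('f, 'r, 'd) module_scheme" and q :: 'f
    and a :: "nat list \<Rightarrow> 'r" and m n k :: nat
  assumes R: "assoc_algebra F R" and q: "q \<in> carrier F" and k: "k \<in> {1..m}"
    and a: "\<And>\<iota>. \<iota> \<in> multi_indices n m \<Longrightarrow> a \<iota> \<in> carrier R"
  \<comment> \<open>The exponent \<open>m - 1\<close> must not be rewritten to \<open>m - Suc 0\<close> by the simplifier.\<close>
  notes [simp del] = One_nat_def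
begin

interpretation R: assoc_algebra F R by (fact R)

lemma base_cring: "cring F" by (rule R.R.is_cring)

interpretation Pow: assoc_algebra F "tensor_power F (quantum_exterior F q n) (m - 1)"
  by (intro tensor_power_assoc_algebra quantum_exterior_assoc_algebra base_cring q)

interpretation T: assoc_algebra F "tensor_space F q R m n"
  by (rule tensor_space_assoc_algebra[OF R q])

interpretation pure: bilinear_map F R "tensor_power F (quantum_exterior F q n) (m - 1)"
    "tensor_space F q R m n" "pure_tensor F R (tensor_power F (quantum_exterior F q n) (m - 1))"
  unfolding tensor_space_def by (rule pure_tensor_bilinear(1)[OF R Pow.assoc_algebra_axioms])

lemma gen_tensor_closed:
  "\<alpha> \<in> multi_indices n (m - 1) \<Longrightarrow>
    gen_tensor F q m n \<alpha> \<in> carrier (tensor_power F (quantum_exterior F q n) (m - 1))"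
  unfolding gen_tensor_def
  by (intro multilinear_map.map_closed[OF power_tensor_multilinear(1)] gen_list_closed[OF base_cring q]
      quantum_exterior_assoc_algebra[OF base_cring q])

lemma box_tensor_closed:
  assumes "J \<in> pair_boxes n (m - 1)"
  shows "box_tensor F q n J \<in> carrier (tensor_power F (quantum_exterior F q n) (m - 1))"
proof -
  have "length J = m - 1" using assms by (simp add: pair_boxes_def)
  then show ?thesis
    using multilinear_map.map_closed[OF power_tensor_multilinear(1)[OF
          quantum_exterior_assoc_algebra[OF base_cring q]] box_list_closed[OF base_cring q assms]]
    by (simp add: box_tensor_def[OF base_cring q])
qed

lemma splitting_sum_closed:
  assumes "J \<in> pair_boxes n (m - 1)" "i \<in> {1..n}" "j \<in> {1..n}"
  shows "splitting_sum F q R a k J i j \<in> carrier R"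
  unfolding splitting_sum_def
  using splittings_subset[OF assms(1)] slice_closed[OF a k] assms(2,3) q
  by (intro R.M.finsum_closed) (force intro!: R.smult_closed R.A.m_closed R.R.nat_pow_closed)

lemma slice_form_closed:
  "i \<in> {1..n} \<Longrightarrow> slice_form F q R m n a k i \<in> carrier (tensor_space F q R m n)"
  unfolding slice_form_def
  by (intro T.M.finsum_closed funcsetI pure.map_closed gen_tensor_closed slice_closed[OF a k])

text \<open>
  The normal form of a product of two forms. A pair of multi-indices either agrees in some
  component, and then contributes nothing, or splits exactly one box, so that grouping the double sum
  by boxes produces the splitting sums.
\<close>

lemma slice_form_mult:
  assumes i: "i \<in> {1..n}" and j: "j \<in> {1..n}"
  shows "slice_form F q R m n a k j \<otimes>\<^bsub>tensor_space F q R m n\<^esub> slice_form F q R m n a k i =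
    (\<Oplus>\<^bsub>tensor_space F q R m n\<^esub>J\<in>pair_boxes n (m - 1).
      pure_tensor F R (tensor_power F (quantum_exterior F q n) (m - 1))
        (splitting_sum F q R a k J j i) (box_tensor F q n J))"
proof -
  let ?T = "tensor_space F q R m n" and ?P = "tensor_power F (quantum_exterior F q n) (m - 1)"
  let ?M = "multi_indices n (m - 1)" and ?B = "pair_boxes n (m - 1)" and ?G = "gen_tensor F q m n"
  let ?p = "pure_tensor F R ?P"
  have s: "slice a k i \<alpha> \<in> carrier R" "slice a k j \<alpha> \<in> carrier R" if "\<alpha> \<in> ?M" for \<alpha>
    using slice_closed[OF a k] that i j by auto
  have u: "?p (slice a k i \<alpha>) (?G \<alpha>) \<in> carrier ?T" "?p (slice a k j \<alpha>) (?G \<alpha>) \<in> carrier ?T"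
    if "\<alpha> \<in> ?M" for \<alpha>
    using that by (auto intro!: pure.map_closed s gen_tensor_closed)
  define t where "t p = ?p (slice a k j (fst p) \<otimes>\<^bsub>R\<^esub> slice a k i (snd p))
    (?G (fst p) \<otimes>\<^bsub>?P\<^esub> ?G (snd p))" for p
  have t_eq: "?p (slice a k j \<alpha>) (?G \<alpha>) \<otimes>\<^bsub>?T\<^esub> ?p (slice a k i \<beta>) (?G \<beta>) = t (\<alpha>, \<beta>)"
    if "\<alpha> \<in> ?M" "\<beta> \<in> ?M" for \<alpha> \<beta>
    using that unfolding t_def tensor_space_def
    by (simp add: pure_tensor_bilinear(2)[OF R Pow.assoc_algebra_axioms] s gen_tensor_closed)
  have t_closed: "t p \<in> carrier ?T" if "p \<in> ?M \<times> ?M" for p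
    using that t_eq u by (cases p) (auto simp flip: t_eq intro: T.A.m_closed)
  \<comment> \<open>A pair of multi-indices with \<open>\<alpha> ! s = \<beta> ! s\<close> contributes a factor \<open>x\<^sub>b \<and> x\<^sub>b = 0\<close>.\<close>
  have t_zero: "t p = \<zero>\<^bsub>?T\<^esub>" if p: "p \<in> ?M \<times> ?M" "p \<notin> (\<Union>J\<in>?B. splittings J)" for p
  proof -
    obtain \<alpha> \<beta> where [simp]: "p = (\<alpha>, \<beta>)" and ab: "\<alpha> \<in> ?M" "\<beta> \<in> ?M" using p(1) by auto
    obtain r where "r < m - 1" "\<alpha> ! r = \<beta> ! r" using splittings_cover[OF ab] p(2) by auto
    then have "?G \<alpha> \<otimes>\<^bsub>?P\<^esub> ?G \<beta> = \<zero>\<^bsub>?P\<^esub>"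
      unfolding gen_tensor_def by (rule gen_tensor_mult_coincident[OF base_cring q ab])
    then show ?thesis
      using s ab linear_map.map_zero[OF pure.linear_right] by (simp add: t_def)
  qed
  have t_split: "(\<Oplus>\<^bsub>?T\<^esub>p\<in>splittings J. t p) = ?p (splitting_sum F q R a k J j i) (box_tensor F q n J)"
    if J: "J \<in> ?B" for J
  proof -
    let ?c = "\<lambda>p. (\<ominus>\<^bsub>F\<^esub> q) [^]\<^bsub>F\<^esub> inv_count (fst p) (snd p)"
    let ?s = "\<lambda>p. slice a k j (fst p) \<otimes>\<^bsub>R\<^esub> slice a k i (snd p)"
    have c: "?c p \<in> carrier F" for p using q by simp
    have sp: "?s p \<in> carrier R" if "p \<in> splittings J" for p
      using splittings_subset[OF J] that s by (cases p) (auto intro!: R.A.m_closed)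
    have cs: "?c p \<odot>\<^bsub>R\<^esub> ?s p \<in> carrier R" if "p \<in> splittings J" for p
      using sp[OF that] c by (rule R.smult_closed[rotated])
    interpret L: linear_map F R ?T "\<lambda>y. ?p y (box_tensor F q n J)"
      by (rule pure.linear_left[OF box_tensor_closed[OF J]])
    have "t p = ?p (?c p \<odot>\<^bsub>R\<^esub> ?s p) (box_tensor F q n J)" if p: "p \<in> splittings J" for p
    proof -
      have "?G (fst p) \<otimes>\<^bsub>?P\<^esub> ?G (snd p) = ?c p \<odot>\<^bsub>?P\<^esub> box_tensor F q n J"
        unfolding gen_tensor_def by (rule gen_tensor_mult_splitting[OF base_cring q J]) (simp add: p)
      then show ?thesis
        by (simp add: t_def pure.map_smult_left pure.map_smult_right c sp[OF p] box_tensor_closed[OF J])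
    qed
    then have "(\<Oplus>\<^bsub>?T\<^esub>p\<in>splittings J. t p) =
        (\<Oplus>\<^bsub>?T\<^esub>p\<in>splittings J. ?p (?c p \<odot>\<^bsub>R\<^esub> ?s p) (box_tensor F q n J))"
      using cs by (intro T.M.finsum_cong') auto
    also have "\<dots> = ?p (splitting_sum F q R a k J j i) (box_tensor F q n J)"
      unfolding splitting_sum_def
      using finite_subset[OF splittings_subset[OF J]] finite_multi_indices cs
      by (intro L.map_finsum[symmetric]) auto
    finally show ?thesis .
  qed
  have "slice_form F q R m n a k j \<otimes>\<^bsub>?T\<^esub> slice_form F q R m n a k i =
      (\<Oplus>\<^bsub>?T\<^esub>\<alpha>\<in>?M. ?p (slice a k j \<alpha>) (?G \<alpha>) \<otimes>\<^bsub>?T\<^esub> (\<Oplus>\<^bsub>?T\<^esub>\<beta>\<in>?M. ?p (slice a k i \<beta>) (?G \<beta>)))"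
    unfolding slice_form_def using u finite_multi_indices
    by (intro T.A.finsum_ldistr) (auto intro!: T.M.finsum_closed)
  also have "\<dots> = (\<Oplus>\<^bsub>?T\<^esub>\<alpha>\<in>?M. \<Oplus>\<^bsub>?T\<^esub>\<beta>\<in>?M. t (\<alpha>, \<beta>))"
  proof (intro T.M.finsum_cong' refl)
    fix \<alpha> assume \<alpha>: "\<alpha> \<in> ?M"
    have "?p (slice a k j \<alpha>) (?G \<alpha>) \<otimes>\<^bsub>?T\<^esub> (\<Oplus>\<^bsub>?T\<^esub>\<beta>\<in>?M. ?p (slice a k i \<beta>) (?G \<beta>)) =
        (\<Oplus>\<^bsub>?T\<^esub>\<beta>\<in>?M. ?p (slice a k j \<alpha>) (?G \<alpha>) \<otimes>\<^bsub>?T\<^esub> ?p (slice a k i \<beta>) (?G \<beta>))"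
      using u \<alpha> finite_multi_indices by (intro T.A.finsum_rdistr) auto
    also have "\<dots> = (\<Oplus>\<^bsub>?T\<^esub>\<beta>\<in>?M. t (\<alpha>, \<beta>))"
      using \<alpha> t_closed by (intro T.M.finsum_cong') (auto simp: t_eq)
    finally show "?p (slice a k j \<alpha>) (?G \<alpha>) \<otimes>\<^bsub>?T\<^esub> (\<Oplus>\<^bsub>?T\<^esub>\<beta>\<in>?M. ?p (slice a k i \<beta>) (?G \<beta>)) =
        (\<Oplus>\<^bsub>?T\<^esub>\<beta>\<in>?M. t (\<alpha>, \<beta>))" .
  qed (auto intro!: T.M.finsum_closed t_closed)
  also have "\<dots> = (\<Oplus>\<^bsub>?T\<^esub>p\<in>?M \<times> ?M. t p)"
    using finite_multi_indices t_closed by (intro T.M.finsum_cartesian[symmetric]) auto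
  also have "\<dots> = (\<Oplus>\<^bsub>?T\<^esub>p\<in>(\<Union>J\<in>?B. splittings J). t p)"
    using splittings_subset t_zero t_closed finite_multi_indices
    by (intro T.M.add.finprod_mono_neutral_cong_right) blast+
  also have "\<dots> = (\<Oplus>\<^bsub>?T\<^esub>J\<in>?B. \<Oplus>\<^bsub>?T\<^esub>p\<in>splittings J. t p)"
  proof (rule T.M.add.finprod_UN_disjoint)
    show "finite ?B" by (rule finite_pair_boxes)
    show "finite (splittings J)" if "J \<in> ?B" for J
      using splittings_subset[OF that] finite_multi_indices by (auto intro: finite_subset)
    show "pairwise (\<lambda>J K. disjnt (splittings J) (splittings K)) ?B"
      using splittings_disjoint by (auto simp: pairwise_def disjnt_def)
    show "t p \<in> carrier ?T" if "J \<in> ?B" "p \<in> splittings J" for J p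
      using splittings_subset[OF that(1)] that(2) t_closed by auto
  qed
  also have "\<dots> = (\<Oplus>\<^bsub>?T\<^esub>J\<in>?B. ?p (splitting_sum F q R a k J j i) (box_tensor F q n J))"
    using i j
    by (intro T.M.finsum_cong') (auto simp: t_split intro!: pure.map_closed splitting_sum_closed box_tensor_closed)
  finally show ?thesis .
qed

text \<open>
  The box tensors are linearly independent with coefficients in \<open>R\<close>: the bilinear map
  \<open>(y, z) \<mapsto> \<psi>(z) y\<close>, with \<open>\<psi>\<close> the coordinate at \<open>J\<close>, induces a linear map that extracts the
  coefficient of \<open>J\<close>.
\<close>

lemma tensor_space_coordinate:
  assumes J: "J \<in> pair_boxes n (m - 1)"
  obtains \<theta> where "linear_map F (tensor_space F q R m n) R \<theta>"
    and "\<And>f. f \<in> pair_boxes n (m - 1) \<rightarrow> carrier R \<Longrightarrow>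
      \<theta> (\<Oplus>\<^bsub>tensor_space F q R m n\<^esub>K\<in>pair_boxes n (m - 1).
        pure_tensor F R (tensor_power F (quantum_exterior F q n) (m - 1)) (f K) (box_tensor F q n K)) = f J"
proof -
  let ?T = "tensor_space F q R m n" and ?P = "tensor_power F (quantum_exterior F q n) (m - 1)"
  let ?B = "pair_boxes n (m - 1)"
  obtain \<psi> where \<psi>: "linear_map F ?P (regular_module F) \<psi>"
    "\<And>K. K \<in> ?B \<Longrightarrow> \<psi> (box_tensor F q n K) = (if K = J then \<one>\<^bsub>F\<^esub> else \<zero>\<^bsub>F\<^esub>)"
    using box_tensor_coordinate[OF base_cring q J] by blast
  interpret \<psi>: linear_map F ?P "regular_module F" \<psi> by (fact \<psi>(1))
  have \<psi>_closed: "\<psi> y \<in> carrier F" if "y \<in> carrier ?P" for y using \<psi>.map_closed[OF that] by simp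
  have "bilinear_map F R ?P R (\<lambda>y z. \<psi> z \<odot>\<^bsub>R\<^esub> y)"
    by (intro bilinear_map.intro bilinear_map_axioms.intro R.module_axioms Pow.module_axioms)
       (simp_all add: \<psi>_closed \<psi>.map_add \<psi>.map_smult R.smult_l_distr R.smult_r_distr R.R.m_comm
          flip: R.smult_assoc1)
  then obtain \<theta> where \<theta>: "linear_map F ?T R \<theta>"
    "\<And>y z. \<lbrakk>y \<in> carrier R; z \<in> carrier ?P\<rbrakk> \<Longrightarrow> \<theta> (pure_tensor F R ?P y z) = \<psi> z \<odot>\<^bsub>R\<^esub> y"
    by (rule tensor_algebra_universal[OF R Pow.assoc_algebra_axioms])
       (rule that, simp_all only: tensor_space_def)
  interpret \<theta>: linear_map F ?T R \<theta> by (fact \<theta>(1))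
  show thesis
  proof (rule that[OF \<theta>(1)])
    fix f assume f: "f \<in> ?B \<rightarrow> carrier R"
    have "\<theta> (\<Oplus>\<^bsub>?T\<^esub>K\<in>?B. pure_tensor F R ?P (f K) (box_tensor F q n K)) =
        (\<Oplus>\<^bsub>R\<^esub>K\<in>?B. \<theta> (pure_tensor F R ?P (f K) (box_tensor F q n K)))"
      using f finite_pair_boxes
      by (intro \<theta>.map_finsum) (auto intro!: pure.map_closed box_tensor_closed)
    also have "\<dots> = (\<Oplus>\<^bsub>R\<^esub>K\<in>?B. if K = J then f J else \<zero>\<^bsub>R\<^esub>)"
      using f J by (intro R.M.finsum_cong') (auto simp: \<theta>(2) \<psi>(2) box_tensor_closed Pi_iff)
    also have "\<dots> = f J"
      using f J by (subst R.M.finsum_delta[OF finite_pair_boxes]) auto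
    finally show "\<theta> (\<Oplus>\<^bsub>?T\<^esub>K\<in>?B. pure_tensor F R ?P (f K) (box_tensor F q n K)) = f J" .
  qed
qed

text \<open>
  A proportionality between two products of forms amounts to the same proportionality between their
  coefficients. The scalar \<open>c\<close> covers both kinds of relations: \<open>c = -q\<close> for the commutation
  relations and \<open>c = 0\<close> for the vanishing of squares.
\<close>

lemma slice_form_mult_eq_iff:
  assumes "i \<in> {1..n}" "j \<in> {1..n}" "i' \<in> {1..n}" "j' \<in> {1..n}" and c: "c \<in> carrier F"
  shows "slice_form F q R m n a k j \<otimes>\<^bsub>tensor_space F q R m n\<^esub> slice_form F q R m n a k i =
      c \<odot>\<^bsub>tensor_space F q R m n\<^esub>
        (slice_form F q R m n a k j' \<otimes>\<^bsub>tensor_space F q R m n\<^esub> slice_form F q R m n a k i') \<longleftrightarrow>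
    (\<forall>J\<in>pair_boxes n (m - 1).
      splitting_sum F q R a k J j i = c \<odot>\<^bsub>R\<^esub> splitting_sum F q R a k J j' i')"
proof -
  let ?T = "tensor_space F q R m n" and ?P = "tensor_power F (quantum_exterior F q n) (m - 1)"
  let ?B = "pair_boxes n (m - 1)" and ?S = "splitting_sum F q R a k"
  let ?sum = "\<lambda>f. \<Oplus>\<^bsub>?T\<^esub>J\<in>?B. pure_tensor F R ?P (f J) (box_tensor F q n J)"
  note S = splitting_sum_closed
  have "c \<odot>\<^bsub>?T\<^esub> ?sum (\<lambda>J. ?S J j' i') =
      (\<Oplus>\<^bsub>?T\<^esub>J\<in>?B. c \<odot>\<^bsub>?T\<^esub> pure_tensor F R ?P (?S J j' i') (box_tensor F q n J))"
    using assms by (intro T.finsum_smult_ldistr finite_pair_boxes)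
      (auto intro!: pure.map_closed S box_tensor_closed simp del: atLeastAtMost_iff)
  also have "\<dots> = ?sum (\<lambda>J. c \<odot>\<^bsub>R\<^esub> ?S J j' i')"
    using assms by (intro T.M.finsum_cong')
      (simp_all add: Pi_def pure.map_smult_left S box_tensor_closed del: atLeastAtMost_iff)
  finally have scaled: "c \<odot>\<^bsub>?T\<^esub> ?sum (\<lambda>J. ?S J j' i') = ?sum (\<lambda>J. c \<odot>\<^bsub>R\<^esub> ?S J j' i')" .
  have "?sum (\<lambda>J. ?S J j i) = ?sum (\<lambda>J. c \<odot>\<^bsub>R\<^esub> ?S J j' i') \<longleftrightarrow>
      (\<forall>J\<in>?B. ?S J j i = c \<odot>\<^bsub>R\<^esub> ?S J j' i')"
  proof
    assume eq: "?sum (\<lambda>J. ?S J j i) = ?sum (\<lambda>J. c \<odot>\<^bsub>R\<^esub> ?S J j' i')"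
    show "\<forall>J\<in>?B. ?S J j i = c \<odot>\<^bsub>R\<^esub> ?S J j' i'"
    proof
      fix J assume "J \<in> ?B"
      then obtain \<theta> where \<theta>: "\<And>f. f \<in> ?B \<rightarrow> carrier R \<Longrightarrow> \<theta> (?sum f) = f J"
        by (rule tensor_space_coordinate) (rule that)
      have "?S J j i = \<theta> (?sum (\<lambda>J. ?S J j i))" using assms S by (intro \<theta>[symmetric]) auto
      also have "\<dots> = c \<odot>\<^bsub>R\<^esub> ?S J j' i'" unfolding eq using assms S by (intro \<theta>) auto
      finally show "?S J j i = c \<odot>\<^bsub>R\<^esub> ?S J j' i'" .
    qed
  next
    assume "\<forall>J\<in>?B. ?S J j i = c \<odot>\<^bsub>R\<^esub> ?S J j' i'"
    then show "?sum (\<lambda>J. ?S J j i) = ?sum (\<lambda>J. c \<odot>\<^bsub>R\<^esub> ?S J j' i')"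
      using assms S by (intro T.M.finsum_cong')
        (auto intro!: pure.map_closed box_tensor_closed simp del: atLeastAtMost_iff)
  qed
  then show ?thesis using assms by (simp add: slice_form_mult scaled del: atLeastAtMost_iff)
qed

end

theorem theorem2p2:
  fixes F :: "('f, 'c) ring_scheme"
    and R :: "('f, 'r, 'd) module_scheme"
    and \<phi> :: "complex \<Rightarrow> 'f"
    and q :: complex
    and a :: "nat list \<Rightarrow> 'r"
    and m n k :: nat
  defines "T \<equiv> tensor_space F (\<phi> q) R m n"
    and "x \<equiv> slice_form F (\<phi> q) R m n a k"
    and "S \<equiv> splitting_sum F (\<phi> q) R a k"
  assumes "field F"
    and "\<phi> \<in> ring_hom ring_of_type_algebra F"
    and "q \<noteq> 0" and "q\<^sup>2 \<noteq> -1"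
    and "assoc_algebra F R"
    and "m \<ge> 1" and "n \<ge> 1" and "k \<in> {1..m}"
    and "\<And>\<iota>. \<iota> \<in> multi_indices n m \<Longrightarrow> a \<iota> \<in> carrier R"
  shows "((\<forall>i j. 1 \<le> i \<and> i < j \<and> j \<le> n \<longrightarrow>
              x j \<otimes>\<^bsub>T\<^esub> x i = (\<ominus>\<^bsub>F\<^esub> \<phi> q) \<odot>\<^bsub>T\<^esub> (x i \<otimes>\<^bsub>T\<^esub> x j)) \<and>
          (\<forall>i. 1 \<le> i \<and> i \<le> n \<longrightarrow> x i \<otimes>\<^bsub>T\<^esub> x i = \<zero>\<^bsub>T\<^esub>))
     \<longleftrightarrow>
         (\<forall>J \<in> pair_boxes n (m - 1).
            (\<forall>i. 1 \<le> i \<and> i \<le> n \<longrightarrow> S J i i = \<zero>\<^bsub>R\<^esub>) \<and>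
            (\<forall>i j. 1 \<le> i \<and> i < j \<and> j \<le> n \<longrightarrow>
              S J j i = (\<ominus>\<^bsub>F\<^esub> \<phi> q) \<odot>\<^bsub>R\<^esub> S J i j))"
proof -
  interpret R: assoc_algebra F R by fact
  have q: "\<phi> q \<in> carrier F"
    using ring_hom_closed[OF assms(5), of q] by (simp add: ring_of_type_algebra_def)
  have k: "k \<in> {1..m}" by fact
  interpret T: assoc_algebra F T
    unfolding T_def by (rule tensor_space_assoc_algebra[OF \<open>assoc_algebra F R\<close> q])
  note iff = slice_form_mult_eq_iff[where n = n and a = a, OF \<open>assoc_algebra F R\<close> q k assms(12), folded T_def x_def S_def]
  have S: "S J i j \<in> carrier R" if "J \<in> pair_boxes n (m - 1)" "i \<in> {1..n}" "j \<in> {1..n}" for J i j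
    using splitting_sum_closed[where n = n and a = a, OF \<open>assoc_algebra F R\<close> q k assms(12)] that by (simp add: S_def)
  have x: "x i \<in> carrier T" if "i \<in> {1..n}" for i
    using slice_form_closed[where n = n and a = a, OF \<open>assoc_algebra F R\<close> q k assms(12) that] by (simp add: x_def T_def)
  have swap: "x j \<otimes>\<^bsub>T\<^esub> x i = (\<ominus>\<^bsub>F\<^esub> \<phi> q) \<odot>\<^bsub>T\<^esub> (x i \<otimes>\<^bsub>T\<^esub> x j) \<longleftrightarrow>
      (\<forall>J\<in>pair_boxes n (m - 1). S J j i = (\<ominus>\<^bsub>F\<^esub> \<phi> q) \<odot>\<^bsub>R\<^esub> S J i j)"
    if "1 \<le> i" "i < j" "j \<le> n" for i j
    using iff[where i = i and j = j and i' = j and j' = i and c = "\<ominus>\<^bsub>F\<^esub> \<phi> q"] that q by simp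
  \<comment> \<open>The square is zero iff it equals its multiple by \<open>0\<close>.\<close>
  have square: "x i \<otimes>\<^bsub>T\<^esub> x i = \<zero>\<^bsub>T\<^esub> \<longleftrightarrow> (\<forall>J\<in>pair_boxes n (m - 1). S J i i = \<zero>\<^bsub>R\<^esub>)"
    if "1 \<le> i" "i \<le> n" for i
    using iff[of i i i i "\<zero>\<^bsub>F\<^esub>"] that x S by simp
  have "(\<forall>i j. 1 \<le> i \<and> i < j \<and> j \<le> n \<longrightarrow>
        x j \<otimes>\<^bsub>T\<^esub> x i = (\<ominus>\<^bsub>F\<^esub> \<phi> q) \<odot>\<^bsub>T\<^esub> (x i \<otimes>\<^bsub>T\<^esub> x j)) \<longleftrightarrow>
      (\<forall>i j. 1 \<le> i \<and> i < j \<and> j \<le> n \<longrightarrow>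
        (\<forall>J\<in>pair_boxes n (m - 1). S J j i = (\<ominus>\<^bsub>F\<^esub> \<phi> q) \<odot>\<^bsub>R\<^esub> S J i j))"
    by (simp only: swap cong: imp_cong)
  moreover have "(\<forall>i. 1 \<le> i \<and> i \<le> n \<longrightarrow> x i \<otimes>\<^bsub>T\<^esub> x i = \<zero>\<^bsub>T\<^esub>) \<longleftrightarrow>
      (\<forall>i. 1 \<le> i \<and> i \<le> n \<longrightarrow> (\<forall>J\<in>pair_boxes n (m - 1). S J i i = \<zero>\<^bsub>R\<^esub>))"
    by (simp only: square cong: imp_cong)
  ultimately show ?thesis by meson
qed

end
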